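(* Let $1\le n\le\omega$. Then: (i) the set $$\{(F,G)\in\operatorname{Aut}_+(\mathcal C_n)\times\operatorname{Aut}(\mathcal C_n): F\text{ and }G\text{ freely generate a dense subgroup of }\operatorname{Aut}(\mathcal C_n)\}$$ is comeager in $\operatorname{Aut}_+(\mathcal C_n)\times\operatorname{Aut}(\mathcal C_n)$; (ii) for every natural number $m\ge 1$, the set of cyclically dense elements $\bar G\in\operatorname{Aut}(\mathcal C_n)^m$ for the diagonal action is comeager in $\operatorname{Aut}(\mathcal C_n)^m$.
   Context: Here $n$ is a positive integer or $n=\omega$. $A_n=\{1,\dots,n\}$ for finite $n$ and $A_\omega=\{1,2,3,\dots\}$. $\mathcal C_n$ (the chain of antichains) is the poset with underlying set $A_n\times\mathbb Q$ and strict order $(k,p)<(l,q)\iff p<q$ (so distinct elements with the same second coordinate are incomparable). With $\pi_2(k,p)=p$, $\operatorname{Aut}_+(\mathcal C_n):=\{F\in\operatorname{Aut}(\mathcal C_n):\pi_2(F(k,p))>p\text{ for all }(k,p)\in\mathcal C_n\}$. $\operatorname{Aut}(\mathcal C_n)$ carries the topology with basic open sets $\{\bar F: F\subset\bar F\}$, $F$ an isomorphism between finite subposets; products and subspaces have the product and subspace topologies. For a topological group $G$, $\bar g=(g_1,\dots,g_m)\in G^m$ is cyclically dense for the diagonal action of $G$ on $G^m$ if for some $f\in G$ the set $\{(f^kg_1f^{-k},\dots,f^kg_mf^{-k}):k\in\mathbb Z\}$ is dense in $G^m$. Comeager means complement of a countable union of nowhere dense sets. "$F$ and $G$ freely generate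 a dense subgroup" means that $w(F,G)\ne\operatorname{id}$ for every irreducible word $w(a,b)$ (an expression $c_1^{n_1}\cdots c_k^{n_k}$, $k\ge1$, $c_i\in\{a,b\}$, $n_i\in\mathbb Z\setminus\{0\}$, $c_i\neq c_{i+1}$) and $\langle F,G\rangle$ is dense. *)

theory Defs
  imports
    "HOL-Analysis.Product_Topology"
    "HOL-Analysis.Function_Topology"
    "HOL-Algebra.Bij"
    "HOL-Algebra.Generated_Groups"
    "HOL-Library.Extended_Nat"
begin

section \<open>Comeager and dense sets, cyclic density, free generation\<close>

definition dense_in :: "'a topology \<Rightarrow> 'a set \<Rightarrow> bool" where
  "dense_in X S \<longleftrightarrow> S \<subseteq> topspace X \<and> X closure_of S = topspace X"

definition nowhere_dense_in :: "'a topology \<Rightarrow> 'a set \<Rightarrow> bool" where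
  "nowhere_dense_in X S \<longleftrightarrow> S \<subseteq> topspace X \<and> X interior_of (X closure_of S) = {}"

definition comeager_in :: "'a topology \<Rightarrow> 'a set \<Rightarrow> bool" where
  "comeager_in X S \<longleftrightarrow>
     (\<exists>\<N>. countable \<N> \<and> (\<forall>N\<in>\<N>. nowhere_dense_in X N) \<and> S = topspace X - \<Union>\<N>)"

definition cyclically_dense ::
  "('a, 'b) monoid_scheme \<Rightarrow> 'a topology \<Rightarrow> nat \<Rightarrow> (nat \<Rightarrow> 'a) \<Rightarrow> bool" where
  "cyclically_dense G T m g \<longleftrightarrow>
     g \<in> {1..m} \<rightarrow>\<^sub>E carrier G \<and>
     (\<exists>f\<in>carrier G.
        dense_in (product_topology (\<lambda>_. T) {1..m})
          (range (\<lambda>k::int. \<lambda>i\<in>{1..m}. f [^]\<^bsub>G\<^esub> k \<otimes>\<^bsub>G\<^esub> g i \<otimes>\<^bsub>G\<^esub> f [^]\<^bsub>G\<^esub> (- k))))"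

datatype letter = LetterA | LetterB

text \<open>The list \<open>[(c\<^sub>1, n\<^sub>1), \<dots>, (c\<^sub>k, n\<^sub>k)]\<close> stands for the word
  with successive powers \<open>c\<^sub>i\<close> to the \<open>n\<^sub>i\<close>.\<close>

type_synonym word = "(letter \<times> int) list"

definition irreducible_word :: "word \<Rightarrow> bool" where
  "irreducible_word w \<longleftrightarrow>
     w \<noteq> [] \<and> (\<forall>(c, k)\<in>set w. k \<noteq> 0) \<and> distinct_adj (map fst w)"

primrec eval_letter :: "'a \<Rightarrow> 'a \<Rightarrow> letter \<Rightarrow> 'a" where
  "eval_letter x y LetterA = x"
| "eval_letter x y LetterB = y"

definition eval_word :: "('a, 'b) monoid_scheme \<Rightarrow> 'a \<Rightarrow> 'a \<Rightarrow> word \<Rightarrow> 'a" where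
  "eval_word G x y w =
     foldr (\<lambda>(c, k) z. eval_letter x y c [^]\<^bsub>G\<^esub> k \<otimes>\<^bsub>G\<^esub> z) w \<one>\<^bsub>G\<^esub>"

definition freely_generate_dense_subgroup ::
  "('a, 'b) monoid_scheme \<Rightarrow> 'a topology \<Rightarrow> 'a \<Rightarrow> 'a \<Rightarrow> bool" where
  "freely_generate_dense_subgroup G T x y \<longleftrightarrow>
     (\<forall>w. irreducible_word w \<longrightarrow> eval_word G x y w \<noteq> \<one>\<^bsub>G\<^esub>) \<and>
     dense_in T (generate G {x, y})"

section \<open>The chain of antichains and its automorphism group\<close>

text \<open>The value \<open>\<infinity>\<close> of the parameter \<open>n\<close> plays the role of \<open>\<omega>\<close>; it adds no element to
  the index set, which consists of natural numbers.\<close>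

definition index_set :: "enat \<Rightarrow> nat set" where
  "index_set n = {k. 1 \<le> k \<and> enat k \<le> n}"

definition chain_antichains :: "enat \<Rightarrow> (nat \<times> rat) set" where
  "chain_antichains n = index_set n \<times> (UNIV :: rat set)"

definition chain_less :: "nat \<times> rat \<Rightarrow> nat \<times> rat \<Rightarrow> bool" where
  "chain_less x y \<longleftrightarrow> snd x < snd y"

definition chain_iso :: "(nat \<times> rat) set \<Rightarrow> (nat \<times> rat) set \<Rightarrow> (nat \<times> rat \<Rightarrow> nat \<times> rat) \<Rightarrow> bool" where
  "chain_iso S T f \<longleftrightarrow>
     bij_betw f S T \<and> (\<forall>x\<in>S. \<forall>y\<in>S. chain_less x y \<longleftrightarrow> chain_less (f x) (f y))"

text \<open>Automorphisms are extensional functions, as in \<^const>\<open>Bij\<close>: they take the value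
  \<^const>\<open>undefined\<close> outside the poset, so that equal automorphisms are equal functions.\<close>

definition Aut :: "enat \<Rightarrow> (nat \<times> rat \<Rightarrow> nat \<times> rat) set" where
  "Aut n = {F \<in> extensional (chain_antichains n).
              chain_iso (chain_antichains n) (chain_antichains n) F}"

definition Aut_plus :: "enat \<Rightarrow> (nat \<times> rat \<Rightarrow> nat \<times> rat) set" where
  "Aut_plus n = {F \<in> Aut n. \<forall>x\<in>chain_antichains n. snd x < snd (F x)}"

definition Aut_group :: "enat \<Rightarrow> (nat \<times> rat \<Rightarrow> nat \<times> rat) monoid" where
  "Aut_group n = BijGroup (chain_antichains n) \<lparr>carrier := Aut n\<rparr>"

text \<open>A finite partial isomorphism is given by its domain \<open>D\<close>, its range \<open>E\<close> and a function
  \<open>f\<close> of which only the values on \<open>D\<close> matter.\<close>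

definition Aut_basic_open ::
  "enat \<Rightarrow> (nat \<times> rat) set \<Rightarrow> (nat \<times> rat \<Rightarrow> nat \<times> rat) \<Rightarrow> (nat \<times> rat \<Rightarrow> nat \<times> rat) set" where
  "Aut_basic_open n D f = {F \<in> Aut n. \<forall>x\<in>D. F x = f x}"

definition Aut_basis :: "enat \<Rightarrow> (nat \<times> rat \<Rightarrow> nat \<times> rat) set set" where
  "Aut_basis n = {Aut_basic_open n D f | D E f.
     finite D \<and> D \<subseteq> chain_antichains n \<and> E \<subseteq> chain_antichains n \<and> chain_iso D E f}"

text \<open>The intersection of two members of \<^const>\<open>Aut_basis\<close> is empty or a member again, so the
  open sets are exactly the unions of members.\<close>

definition Aut_topology :: "enat \<Rightarrow> (nat \<times> rat \<Rightarrow> nat \<times> rat) topology" where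
  "Aut_topology n = topology_generated_by (Aut_basis n)"

end

theory Submission
  imports Defs "HOL-Analysis.Finite_Cartesian_Product"
begin

text \<open>
  An automorphism of the chain of antichains permutes the fibres of the second projection by an order
  automorphism of the rationals, and acts on every fibre by an arbitrary permutation. Therefore every
  finite partial isomorphism extends to an automorphism, and a lower bound for the displacement of the
  second coordinate is inherited by the extension
  (\<open>finite_partial_isomorphism_extends\<close>). In particular two finite conditions can be realised
  simultaneously as soon as one of them lies above the other (\<open>glue_automorphisms\<close>).

  Let \<open>K\<close> move every point up by at least a fixed positive amount. Conjugation by high powers of \<open>K\<close>
  moves any finite condition above any other one. So there is an automorphism \<open>F\<close> that satisfies one
  given finite condition while a conjugate of \<open>F\<close> by a power of \<open>K\<close> satisfies a second one
  (\<open>conjugates_transitive\<close>). This is topological transitivity of the conjugation action of \<open>K\<close>, and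
  Birkhoff's category argument (\<open>comeager_dense_orbit\<close>) turns it into a comeager set of points with
  dense orbits. With the translation as \<open>K\<close>, applied in each coordinate, it proves the claim about
  cyclically dense tuples. For pairs \<open>(F, G)\<close> the role of \<open>K\<close> is played by the first component, which
  can be made uniformly increasing within any open set; hence for a comeager set of pairs the
  conjugates of \<open>G\<close> by powers of \<open>F\<close> are dense, and so is the group generated by the pair.

  Freeness is a countable intersection over the irreducible words \<open>w\<close>. The pairs with
  \<open>w(F, G) \<noteq> id\<close> form an open set that is invariant under simultaneous conjugation. Transitivity
  reduces its density to its being nonempty, and a pair of piecewise linear maps that play ping-pong
  on the line lies in it for all \<open>w\<close> (\<open>irreducible_word_nontrivial\<close>).
\<close>

section \<open>Comeager sets and dense orbits\<close>

lemma dense_in_iff_meets_open: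
  "dense_in X S \<longleftrightarrow> S \<subseteq> topspace X \<and> (\<forall>U. openin X U \<and> U \<noteq> {} \<longrightarrow> S \<inter> U \<noteq> {})"
  by (simp add: dense_in_def dense_intersects_open)

lemma nowhere_dense_in_subset:
  assumes "nowhere_dense_in X N" "M \<subseteq> N"
  shows "nowhere_dense_in X M"
proof -
  have "X interior_of (X closure_of M) \<subseteq> X interior_of (X closure_of N)"
    by (intro interior_of_mono closure_of_mono assms(2))
  then show ?thesis using assms unfolding nowhere_dense_in_def by auto
qed

lemma comeager_in_mono:
  assumes "comeager_in X S" "S \<subseteq> T" "T \<subseteq> topspace X"
  shows "comeager_in X T"
proof -
  obtain \<N> where \<N>: "countable \<N>" "\<And>N. N \<in> \<N> \<Longrightarrow> nowhere_dense_in X N" "S = topspace X - \<Union>\<N>"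
    using assms(1) unfolding comeager_in_def by (elim exE conjE) simp
  have "countable ((\<lambda>N. N - T) ` \<N>)" using \<N>(1) by (rule countable_image)
  moreover have "\<forall>N\<in>(\<lambda>N. N - T) ` \<N>. nowhere_dense_in X N"
    using \<N>(2) by (auto intro: nowhere_dense_in_subset)
  moreover have "T = topspace X - \<Union>((\<lambda>N. N - T) ` \<N>)"
    using assms(2,3) \<N>(3) by auto
  ultimately show ?thesis unfolding comeager_in_def by (intro exI[of _ "(\<lambda>N. N - T) ` \<N>"] conjI)
qed

lemma comeager_in_INT:
  assumes "countable I" "\<And>i. i \<in> I \<Longrightarrow> comeager_in X (S i)"
  shows "comeager_in X (topspace X \<inter> (\<Inter>i\<in>I. S i))"
proof -
  have "\<forall>i\<in>I. \<exists>\<N>. countable \<N> \<and> (\<forall>N\<in>\<N>. nowhere_dense_in X N) \<and> S i = topspace X - \<Union>\<N>"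
    using assms(2) by (simp add: comeager_in_def)
  then obtain \<N> where "\<forall>i\<in>I. countable (\<N> i) \<and> (\<forall>N\<in>\<N> i. nowhere_dense_in X N) \<and>
      S i = topspace X - \<Union>(\<N> i)"
    by (rule bchoice[THEN exE])
  then have \<N>: "\<And>i. i \<in> I \<Longrightarrow> countable (\<N> i)"
      "\<And>i N. i \<in> I \<Longrightarrow> N \<in> \<N> i \<Longrightarrow> nowhere_dense_in X N"
      "\<And>i. i \<in> I \<Longrightarrow> S i = topspace X - \<Union>(\<N> i)"
    by simp_all
  have "countable (\<Union>i\<in>I. \<N> i)" using assms(1) \<N>(1) by (rule countable_UN)
  moreover have "topspace X \<inter> (\<Inter>i\<in>I. S i) = topspace X - \<Union>(\<Union>i\<in>I. \<N> i)"
    using \<N>(3) by auto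
  ultimately show ?thesis unfolding comeager_in_def using \<N>(2) by (intro exI[of _ "\<Union>i\<in>I. \<N> i"]) auto
qed

lemma comeager_in_Int:
  assumes "comeager_in X S" "comeager_in X T"
  shows "comeager_in X (S \<inter> T)"
proof -
  have "comeager_in X (topspace X \<inter> (\<Inter>A\<in>{S, T}. A))"
    by (rule comeager_in_INT) (use assms in auto)
  moreover have "S \<subseteq> topspace X" using assms(1) unfolding comeager_in_def by auto
  then have "topspace X \<inter> (\<Inter>A\<in>{S, T}. A) = S \<inter> T" by auto
  ultimately show ?thesis by simp
qed

lemma comeager_in_open_dense:
  assumes "openin X U" "\<And>V. openin X V \<Longrightarrow> V \<noteq> {} \<Longrightarrow> U \<inter> V \<noteq> {}"
  shows "comeager_in X U"
proof -
  have "dense_in X U"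
    using assms openin_subset[OF assms(1)] unfolding dense_in_iff_meets_open by blast
  then have "nowhere_dense_in X (topspace X - U)"
    using assms(1) unfolding nowhere_dense_in_def dense_in_def
    by (simp add: closure_of_complement interior_of_complement interior_of_openin)
  moreover have "U = topspace X - \<Union>{topspace X - U}"
    using openin_subset[OF assms(1)] by auto
  ultimately show ?thesis unfolding comeager_in_def by (intro exI[of _ "{topspace X - U}"]) simp
qed

text \<open>A \<open>\<pi>\<close>-base: its members need only lie inside the nonempty open sets, they need not form
  neighbourhood bases of points. That is all that density of a set is tested against.\<close>

definition countable_pi_base :: "'a topology \<Rightarrow> 'a set set \<Rightarrow> bool" where
  "countable_pi_base X \<B> \<longleftrightarrow> countable \<B> \<and> (\<forall>B\<in>\<B>. openin X B \<and> B \<noteq> {}) \<and>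
     (\<forall>U. openin X U \<and> U \<noteq> {} \<longrightarrow> (\<exists>B\<in>\<B>. B \<subseteq> U))"

text \<open>Birkhoff's transitivity argument. The points whose orbit enters a fixed basic open set form an
  open set, transitivity makes this open set dense, and countably many basic sets suffice to
  recognise a dense orbit. Source and target may differ: for pairs the orbit is that of the second
  component under conjugation by the first one, so the family \<open>\<phi>\<close> maps pairs to automorphisms.\<close>

lemma comeager_dense_orbit:
  assumes base: "countable_pi_base X \<B>"
    and cont: "\<And>k. continuous_map Z X (\<phi> k)"
    and trans: "\<And>U V. \<lbrakk>openin Z U; U \<noteq> {}; openin X V; V \<noteq> {}\<rbrakk> \<Longrightarrow> \<exists>k. \<exists>z\<in>U. \<phi> k z \<in> V"
  shows "comeager_in Z {z \<in> topspace Z. dense_in X (range (\<lambda>k. \<phi> k z))}"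
proof -
  define W where "W B = {z \<in> topspace Z. \<exists>k. \<phi> k z \<in> B}" for B
  have "comeager_in Z (W B)" if B: "B \<in> \<B>" for B
  proof (rule comeager_in_open_dense)
    have oB: "openin X B" "B \<noteq> {}" using B base unfolding countable_pi_base_def by auto
    have "openin Z (\<Union>k. {z \<in> topspace Z. \<phi> k z \<in> B})"
      using openin_continuous_map_preimage[OF cont oB(1)] by blast
    moreover have "W B = (\<Union>k. {z \<in> topspace Z. \<phi> k z \<in> B})" unfolding W_def by blast
    ultimately show "openin Z (W B)" by simp
    fix V assume V: "openin Z V" "V \<noteq> {}"
    from trans[OF V oB] obtain k z where kz: "z \<in> V" "\<phi> k z \<in> B" by blast
    then have "z \<in> W B" using openin_subset[OF V(1)] unfolding W_def by blast
    then show "W B \<inter> V \<noteq> {}" using kz by blast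
  qed
  moreover have "countable \<B>" using base unfolding countable_pi_base_def by simp
  ultimately have "comeager_in Z (topspace Z \<inter> (\<Inter>B\<in>\<B>. W B))" by (intro comeager_in_INT)
  moreover have "topspace Z \<inter> (\<Inter>B\<in>\<B>. W B)
      \<subseteq> {z \<in> topspace Z. dense_in X (range (\<lambda>k. \<phi> k z))}"
  proof clarify
    fix z assume z: "z \<in> topspace Z" "z \<in> (\<Inter>B\<in>\<B>. W B)"
    show "dense_in X (range (\<lambda>k. \<phi> k z))"
      unfolding dense_in_iff_meets_open
    proof (intro conjI allI impI)
      show "range (\<lambda>k. \<phi> k z) \<subseteq> topspace X"
        using cont z(1) unfolding continuous_map_def by blast
      fix U assume "openin X U \<and> U \<noteq> {}"
      then obtain B where "B \<in> \<B>" "B \<subseteq> U" using base unfolding countable_pi_base_def by blast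
      then show "range (\<lambda>k. \<phi> k z) \<inter> U \<noteq> {}" using z(2) unfolding W_def by blast
    qed
  qed
  ultimately show ?thesis by (rule comeager_in_mono) simp
qed

lemma countable_pi_base_product:
  assumes base: "countable_pi_base X \<B>" and I: "finite I"
  shows "countable_pi_base (product_topology (\<lambda>_. X) I) ((\<lambda>B. Pi\<^sub>E I B) ` (I \<rightarrow>\<^sub>E \<B>))"
  unfolding countable_pi_base_def
proof (intro conjI allI impI ballI)
  have \<B>: "countable \<B>" "\<And>B. B \<in> \<B> \<Longrightarrow> openin X B \<and> B \<noteq> {}"
      "\<And>U. openin X U \<Longrightarrow> U \<noteq> {} \<Longrightarrow> \<exists>B\<in>\<B>. B \<subseteq> U"
    using base unfolding countable_pi_base_def by auto
  show "countable (Pi\<^sub>E I ` (I \<rightarrow>\<^sub>E \<B>))"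
    by (intro countable_image countable_PiE I \<B>(1))
  fix C assume "C \<in> Pi\<^sub>E I ` (I \<rightarrow>\<^sub>E \<B>)"
  then obtain B where B: "B \<in> I \<rightarrow>\<^sub>E \<B>" "C = Pi\<^sub>E I B" by blast
  have B': "openin X (B i) \<and> B i \<noteq> {}" if "i \<in> I" for i using B(1) \<B>(2) that by (auto simp: PiE_iff)
  show "openin (product_topology (\<lambda>_. X) I) C"
    using B' I B(2) by (simp add: openin_PiE_gen)
  show "C \<noteq> {}" using B' B(2) by (auto simp: PiE_eq_empty_iff)
next
  have \<B>: "\<And>U. openin X U \<Longrightarrow> U \<noteq> {} \<Longrightarrow> \<exists>B\<in>\<B>. B \<subseteq> U"
    using base unfolding countable_pi_base_def by auto
  fix U assume U: "openin (product_topology (\<lambda>_. X) I) U \<and> U \<noteq> {}"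
  then obtain x where "x \<in> U" by blast
  then obtain V where V: "\<And>i. openin X (V i)" "x \<in> Pi\<^sub>E I V" "Pi\<^sub>E I V \<subseteq> U"
    using product_topology_open_contains_basis[of "\<lambda>_. X" I U x] U by blast
  have "\<forall>i\<in>I. \<exists>B\<in>\<B>. B \<subseteq> V i" using \<B>[OF V(1)] PiE_mem[OF V(2)] by blast
  then obtain B where B: "\<And>i. i \<in> I \<Longrightarrow> B i \<in> \<B> \<and> B i \<subseteq> V i" by metis
  have "Pi\<^sub>E I (restrict B I) \<subseteq> Pi\<^sub>E I V" by (rule PiE_mono) (use B in auto)
  then have "Pi\<^sub>E I (restrict B I) \<subseteq> U" using V(3) by blast
  moreover have "restrict B I \<in> I \<rightarrow>\<^sub>E \<B>" using B by auto
  ultimately show "\<exists>C\<in>Pi\<^sub>E I ` (I \<rightarrow>\<^sub>E \<B>). C \<subseteq> U"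
    by (intro bexI[of _ "Pi\<^sub>E I (restrict B I)"] imageI)
qed

section \<open>Extending finite partial isomorphisms\<close>

lemma glue_order_bijections:
  fixes \<phi> \<psi> :: "'a::linorder \<Rightarrow> 'b::linorder"
  assumes "strict_mono \<phi>" "surj \<phi>" "strict_mono \<psi>" "surj \<psi>" "\<phi> m = \<psi> m"
  defines "\<theta> \<equiv> \<lambda>p. if p \<le> m then \<phi> p else \<psi> p"
  shows "strict_mono \<theta>" "surj \<theta>"
proof -
  show "strict_mono \<theta>"
  proof (rule strict_monoI)
    fix p q :: 'a assume "p < q"
    consider "q \<le> m" | "p \<le> m" "m < q" | "m < p" by force
    then show "\<theta> p < \<theta> q"
    proof cases
      case 2
      then have "\<phi> p \<le> \<phi> m" "\<psi> m < \<psi> q"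
        using assms(1,3) by (simp_all add: strict_mono_less strict_mono_less_eq)
      then have "\<phi> p < \<psi> q" using assms(5) by simp
      moreover have "\<theta> p = \<phi> p" "\<theta> q = \<psi> q" using 2 by (auto simp: \<theta>_def)
      ultimately show ?thesis by simp
    qed (use \<open>p < q\<close> assms(1,3) in \<open>auto simp: \<theta>_def strict_mono_less\<close>)
  qed
  have "\<exists>p. \<theta> p = y" for y
  proof (cases "y \<le> \<phi> m")
    case True
    obtain p where p: "y = \<phi> p" using assms(2) by (rule surjE)
    moreover from True[unfolded p] have "p \<le> m" using assms(1) by (simp add: strict_mono_less_eq)
    ultimately show ?thesis by (auto simp: \<theta>_def)
  next
    case False
    obtain p where p: "y = \<psi> p" using assms(4) by (rule surjE)
    moreover from False[unfolded p] have "\<not> p \<le> m"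
      using assms(3,5) by (simp add: strict_mono_less_eq)
    ultimately show ?thesis by (auto simp: \<theta>_def)
  qed
  then show "surj \<theta>" unfolding surj_def by metis
qed

lemma affine_order_bijection:
  fixes s :: "'a::linordered_field"
  assumes "s > 0"
  shows "strict_mono (\<lambda>p. c + (p - m) * s)" "surj (\<lambda>p. c + (p - m) * s)"
proof -
  show "strict_mono (\<lambda>p. c + (p - m) * s)"
    using assms by (auto intro!: strict_monoI mult_strict_right_mono)
  show "surj (\<lambda>p. c + (p - m) * s)"
    by (rule surjI[of _ "\<lambda>y. m + (y - c) / s"]) (use assms in simp)
qed

text \<open>Piecewise linear interpolation between the given points and translation outside of them. Any
  prescribed lower bound \<open>\<delta>\<close> of the displacement on \<open>D\<close> persists everywhere, since the displacement
  is interpolated too; for positive \<open>\<delta>\<close> this makes the iterates of the extension tend to infinity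
  at every point.\<close>

lemma finite_partial_order_map_extends:
  fixes f :: "'a::linordered_field \<Rightarrow> 'a"
  assumes "finite D" "strict_mono_on D f"
  shows "\<exists>\<phi>. strict_mono \<phi> \<and> surj \<phi> \<and> (\<forall>p\<in>D. \<phi> p = f p) \<and>
    ((\<forall>p\<in>D. p + \<delta> \<le> f p) \<longrightarrow> (\<forall>p. p + \<delta> \<le> \<phi> p))"
  using assms
proof (induction D rule: finite_linorder_max_induct)
  case empty
  then show ?case
    using affine_order_bijection[of "1::'a" \<delta> 0]
    by (intro exI[of _ "\<lambda>p. \<delta> + (p - 0) * 1"]) simp
next
  case (insert b A)
  have "strict_mono_on A f" using insert.prems by (auto simp: strict_mono_on_def)
  with insert.IH obtain \<phi> where \<phi>: "strict_mono \<phi>" "surj \<phi>" "\<And>p. p \<in> A \<Longrightarrow> \<phi> p = f p"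
      "(\<forall>p\<in>A. p + \<delta> \<le> f p) \<Longrightarrow> (\<forall>p. p + \<delta> \<le> \<phi> p)"
    by auto
  let ?t = "\<lambda>p. f b + (p - b) * 1"
  note \<tau> = affine_order_bijection[of "1::'a" "f b" b, OF zero_less_one]
  show ?case
  proof (cases "A = {}")
    case True
    then show ?thesis using \<tau> by (intro exI[of _ ?t]) auto
  next
    case False
    define m where "m = Max A"
    have m: "m \<in> A" "\<And>a. a \<in> A \<Longrightarrow> a \<le> m" "m < b"
      using insert.hyps False by (auto simp: m_def)
    have fm: "f m < f b"
      using insert.prems m by (auto simp: strict_mono_on_def)
    define s where "s = (f b - f m) / (b - m)"
    have s: "s > 0" using fm m(3) by (simp add: s_def)
    let ?l = "\<lambda>p. f m + (p - m) * s"
    have lb: "?l b = f b" using m(3) by (simp add: s_def)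
    note l = affine_order_bijection[OF s, of "f m" m]
    define \<theta> where "\<theta> = (\<lambda>p. if p \<le> m then \<phi> p else ?l p)"
    have \<theta>: "strict_mono \<theta>" "surj \<theta>"
      unfolding \<theta>_def by (rule glue_order_bijections; use \<phi> l m(1) in simp)+
    define \<omega> where "\<omega> = (\<lambda>p. if p \<le> b then \<theta> p else ?t p)"
    have \<theta>b: "\<theta> b = ?t b" using m(3) lb by (simp add: \<theta>_def)
    have "strict_mono \<omega>" "surj \<omega>"
      unfolding \<omega>_def by (rule glue_order_bijections[OF \<theta> \<tau> \<theta>b])+
    moreover have "\<forall>p\<in>insert b A. \<omega> p = f p"
      using m(2,3) \<phi>(3) \<theta>b by (force simp: \<omega>_def \<theta>_def)
    moreover have "\<forall>p. p + \<delta> \<le> \<omega> p" if \<delta>: "\<forall>p\<in>insert b A. p + \<delta> \<le> f p"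
    proof
      fix p
      have "p + \<delta> \<le> \<phi> p" using \<phi>(4) \<delta> by auto
      moreover have "p + \<delta> \<le> ?t p" using \<delta> by (simp add: algebra_simps)
      \<comment> \<open>The displacement is affine on the segment and at least \<open>\<delta>\<close> at both ends; according to
        the sign of its slope, the left or the right end is the smallest value.\<close>
      moreover have "p + \<delta> \<le> ?l p" if "m < p" "p \<le> b"
      proof (cases "1 \<le> s")
        case True
        then have "(p - m) * 1 \<le> (p - m) * s" using that by (intro mult_left_mono) auto
        moreover have "m + \<delta> \<le> f m" using \<delta> m(1) by simp
        ultimately show ?thesis by simp
      next
        case False
        then have "(b - p) * s \<le> (b - p) * 1" using that by (intro mult_left_mono) auto
        moreover have "b + \<delta> \<le> f b" using \<delta> by simp
        moreover have "?l p = f b - (b - p) * s" using lb by (simp add: algebra_simps)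
        ultimately show ?thesis by simp
      qed
      ultimately show "p + \<delta> \<le> \<omega> p" unfolding \<omega>_def \<theta>_def by auto
    qed
    ultimately show ?thesis by (intro exI[of _ \<omega>] conjI impI)
  qed
qed

text \<open>Outside of \<open>S\<close> and its image the extension is the identity, so that the case of infinite \<open>A\<close>
  needs no separate treatment; \<open>h ` S - S\<close> is mapped onto \<open>S - h ` S\<close>, which has the same size.\<close>

lemma finite_partial_injection_extends:
  assumes "finite S" "S \<subseteq> A" "inj_on h S" "h ` S \<subseteq> A"
  shows "\<exists>\<sigma>. bij_betw \<sigma> A A \<and> (\<forall>k\<in>S. \<sigma> k = h k)"
proof -
  let ?T = "h ` S" and ?U = "S \<union> h ` S"
  have "card (?U - S) = card (?U - ?T)"
    using assms(1) card_image[OF assms(3)] by (simp add: card_Diff_subset)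
  then obtain g where g: "bij_betw g (?U - S) (?U - ?T)"
    using assms(1) finite_same_card_bij[of "?U - S" "?U - ?T"] by auto
  define \<sigma> where "\<sigma> = (\<lambda>k. if k \<in> S then h k else if k \<in> ?U then g k else k)"
  have "bij_betw \<sigma> S ?T"
    using assms(3) by (auto simp: bij_betw_def \<sigma>_def inj_on_def)
  moreover have "bij_betw \<sigma> (?U - S) (?U - ?T)"
    using g by (rule bij_betw_cong[THEN iffD1, rotated]) (auto simp: \<sigma>_def)
  ultimately have "bij_betw \<sigma> (S \<union> (?U - S)) (?T \<union> (?U - ?T))"
    by (rule bij_betw_combine) auto
  moreover have "bij_betw \<sigma> (A - ?U) (A - ?U)"
    by (rule bij_betw_cong[THEN iffD1, of _ id]) (auto simp: \<sigma>_def)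
  ultimately have "bij_betw \<sigma> ((S \<union> (?U - S)) \<union> (A - ?U)) ((?T \<union> (?U - ?T)) \<union> (A - ?U))"
    by (rule bij_betw_combine) auto
  moreover have "(S \<union> (?U - S)) \<union> (A - ?U) = A" "(?T \<union> (?U - ?T)) \<union> (A - ?U) = A"
    using assms(2,4) by auto
  ultimately have "bij_betw \<sigma> A A" by simp
  then show ?thesis by (auto simp: \<sigma>_def)
qed

lemma Aut_fibrewise:
  assumes \<sigma>: "\<And>p. bij_betw (\<sigma> p) (index_set n) (index_set n)" and \<phi>: "strict_mono \<phi>" "surj \<phi>"
  shows "(\<lambda>x\<in>chain_antichains n. (\<sigma> (snd x) (fst x), \<phi> (snd x))) \<in> Aut n" (is "?F \<in> _")
proof -
  let ?C = "chain_antichains n"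
  have "inj_on ?F ?C"
  proof (rule inj_onI)
    fix x y assume xy: "x \<in> ?C" "y \<in> ?C" "?F x = ?F y"
    obtain k p l q where x: "x = (k, p)" and y: "y = (l, q)" by (metis surj_pair)
    have "\<phi> p = \<phi> q" and \<sigma>kl: "\<sigma> p k = \<sigma> q l" using xy x y by simp_all
    then have pq: "p = q" using strict_mono_eq[OF \<phi>(1)] by blast
    moreover have "k = l"
      using xy(1,2) x y \<sigma>kl \<sigma>[of p] unfolding pq
      by (auto simp: bij_betw_def chain_antichains_def dest: inj_onD)
    ultimately show "x = y" using x y by simp
  qed
  moreover have "?F ` ?C = ?C"
  proof (intro equalityI subsetI)
    fix y assume "y \<in> ?F ` ?C"
    then show "y \<in> ?C" by (auto simp: chain_antichains_def bij_betw_apply[OF \<sigma>])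
  next
    fix y assume y: "y \<in> ?C"
    obtain p where p: "snd y = \<phi> p" using \<phi>(2) by (rule surjE)
    have "fst y \<in> \<sigma> p ` index_set n" using y bij_betw_imp_surj_on[OF \<sigma>] by (auto simp: chain_antichains_def)
    then obtain k where k: "k \<in> index_set n" "\<sigma> p k = fst y" by auto
    then have "(k, p) \<in> ?C" "?F (k, p) = y" using p by (simp_all add: chain_antichains_def prod_eq_iff)
    then show "y \<in> ?F ` ?C" by (intro image_eqI[of _ _ "(k, p)"]) simp_all
  qed
  ultimately show ?thesis
    using strict_mono_less[OF \<phi>(1)] by (simp add: Aut_def chain_iso_def bij_betw_def chain_less_def)
qed

text \<open>Ultrahomogeneity of the chain of antichains. Two points are incomparable exactly if their second
  coordinates agree, so a finite partial isomorphism induces a partial order isomorphism of the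
  rationals and a partial injection on each fibre, and these extend independently of each other.\<close>

theorem finite_partial_isomorphism_extends:
  assumes D: "finite D" "D \<subseteq> chain_antichains n" and f: "f ` D \<subseteq> chain_antichains n"
    and iso: "chain_iso D (f ` D) f"
  shows "\<exists>F\<in>Aut n. (\<forall>x\<in>D. F x = f x) \<and>
    ((\<forall>x\<in>D. snd x + \<delta> \<le> snd (f x)) \<longrightarrow> (\<forall>x\<in>chain_antichains n. snd x + \<delta> \<le> snd (F x)))"
proof -
  have less: "snd (f x) < snd (f y) \<longleftrightarrow> snd x < snd y" if "x \<in> D" "y \<in> D" for x y
    using iso that by (auto simp: chain_iso_def chain_less_def)
  have inj: "inj_on f D" using iso by (simp add: chain_iso_def bij_betw_def)
  have eq: "snd (f x) = snd (f y) \<longleftrightarrow> snd x = snd y" if "x \<in> D" "y \<in> D" for x y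
    using less[OF that] less[OF that(2,1)] by (metis linorder_neqE less_irrefl)
  define g where "g p = snd (f (SOME x. x \<in> D \<and> snd x = p))" for p
  have g: "g (snd x) = snd (f x)" if "x \<in> D" for x
  proof -
    have "\<exists>y. y \<in> D \<and> snd y = snd x" using that by blast
    from someI_ex[OF this] show ?thesis unfolding g_def using that by (simp add: eq)
  qed
  have "strict_mono_on (snd ` D) g"
  proof (rule strict_mono_onI)
    fix p q assume "p \<in> snd ` D" "q \<in> snd ` D" "p < q"
    then obtain x y where "x \<in> D" "y \<in> D" "p = snd x" "q = snd y" by blast
    then show "g p < g q" using \<open>p < q\<close> by (simp add: g less)
  qed
  from finite_partial_order_map_extends[OF _ this, of \<delta>] D(1)
  obtain \<phi> where \<phi>: "strict_mono \<phi>" "surj \<phi>" "\<forall>p\<in>snd ` D. \<phi> p = g p"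
      "(\<forall>p\<in>snd ` D. p + \<delta> \<le> g p) \<longrightarrow> (\<forall>p. p + \<delta> \<le> \<phi> p)"
    by auto
  have "\<forall>p. \<exists>\<sigma>. bij_betw \<sigma> (index_set n) (index_set n) \<and>
      (\<forall>k\<in>{k. (k, p) \<in> D}. \<sigma> k = fst (f (k, p)))"
  proof (rule allI, rule finite_partial_injection_extends)
    fix p
    have "{k. (k, p) \<in> D} \<subseteq> fst ` D" by force
    then show "finite {k. (k, p) \<in> D}" using D(1) finite_surj by blast
    show "{k. (k, p) \<in> D} \<subseteq> index_set n" using D(2) by (auto simp: chain_antichains_def)
    show "inj_on (\<lambda>k. fst (f (k, p))) {k. (k, p) \<in> D}"
    proof (rule inj_onI, clarsimp)
      fix k l assume kl: "(k, p) \<in> D" "(l, p) \<in> D" "fst (f (k, p)) = fst (f (l, p))"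
      then have "f (k, p) = f (l, p)" using eq[OF kl(1,2)] by (intro prod_eqI) auto
      then show "k = l" using inj kl by (auto dest: inj_onD)
    qed
    show "(\<lambda>k. fst (f (k, p))) ` {k. (k, p) \<in> D} \<subseteq> index_set n"
      using f by (force simp: chain_antichains_def)
  qed
  then obtain \<sigma> where "\<forall>p. bij_betw (\<sigma> p) (index_set n) (index_set n) \<and>
      (\<forall>k\<in>{k. (k, p) \<in> D}. \<sigma> p k = fst (f (k, p)))"
    by (rule choice[THEN exE])
  then have \<sigma>: "\<And>p. bij_betw (\<sigma> p) (index_set n) (index_set n)"
      "\<And>p k. (k, p) \<in> D \<Longrightarrow> \<sigma> p k = fst (f (k, p))"
    by simp_all
  let ?F = "\<lambda>x\<in>chain_antichains n. (\<sigma> (snd x) (fst x), \<phi> (snd x))"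
  have "?F \<in> Aut n" by (rule Aut_fibrewise) (use \<sigma> \<phi> in auto)
  moreover have "\<forall>x\<in>D. ?F x = f x"
    using D(2) \<sigma>(2) \<phi>(3) g by (auto intro!: prod_eqI)
  moreover have "\<forall>x\<in>chain_antichains n. snd x + \<delta> \<le> snd (?F x)"
    if "\<forall>x\<in>D. snd x + \<delta> \<le> snd (f x)"
    using \<phi>(4) that g by auto
  ultimately show ?thesis by (intro bexI[of _ ?F] conjI impI)
qed

section \<open>Words in a group\<close>

lemma (in group) eval_word_closed:
  assumes "x \<in> carrier G" "y \<in> carrier G"
  shows "eval_word G x y w \<in> carrier G"
proof (induction w)
  case (Cons a w)
  obtain c k where "a = (c, k)" by (cases a)
  moreover have "eval_letter x y c \<in> carrier G" using assms by (cases c) simp_all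
  ultimately show ?case using Cons by (simp add: eval_word_def)
qed (simp add: eval_word_def)

lemma (in group_hom) hom_eval_word:
  assumes "x \<in> carrier G" "y \<in> carrier G"
  shows "h (eval_word G x y w) = eval_word H (h x) (h y) w"
proof (induction w)
  case Nil
  then show ?case by (simp add: eval_word_def)
next
  case (Cons a w)
  obtain c k where a: "a = (c, k)" by (cases a)
  have c: "eval_letter x y c \<in> carrier G" "h (eval_letter x y c) = eval_letter (h x) (h y) c"
    using assms by (cases c; simp)+
  have "eval_word G x y (a # w) = eval_letter x y c [^]\<^bsub>G\<^esub> k \<otimes>\<^bsub>G\<^esub> eval_word G x y w"
    "eval_word H (h x) (h y) (a # w) = h (eval_letter x y c) [^]\<^bsub>H\<^esub> k \<otimes>\<^bsub>H\<^esub> eval_word H (h x) (h y) w"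
    using c(2) by (simp_all add: eval_word_def a)
  then show ?case using Cons c(1) G.eval_word_closed[OF assms] by (simp add: hom_int_pow)
qed

lemma (in group) conj_hom:
  assumes "p \<in> carrier G"
  shows "group_hom G G (\<lambda>x. p \<otimes> x \<otimes> inv p)"
proof -
  have "(\<lambda>x. p \<otimes> x \<otimes> inv p) \<in> hom G G"
  proof (rule homI)
    fix x y assume xy: "x \<in> carrier G" "y \<in> carrier G"
    have "p \<otimes> x \<otimes> inv p \<otimes> (p \<otimes> y \<otimes> inv p) = p \<otimes> x \<otimes> (inv p \<otimes> p) \<otimes> y \<otimes> inv p"
      using assms xy by (simp only: m_assoc m_closed inv_closed)
    then show "p \<otimes> (x \<otimes> y) \<otimes> inv p = p \<otimes> x \<otimes> inv p \<otimes> (p \<otimes> y \<otimes> inv p)"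
      using assms xy by (simp add: m_assoc)
  qed (use assms in simp)
  then show ?thesis using is_group by (simp add: group_hom_def group_hom_axioms_def)
qed

lemma (in group) conj_pow_in_generate:
  fixes k :: int
  assumes "x \<in> carrier G" "y \<in> carrier G"
  shows "x [^] k \<otimes> y \<otimes> x [^] (- k) \<in> generate G {x, y}"
proof -
  have sub: "subgroup (generate G {x, y}) G" using assms by (intro generate_is_subgroup) simp
  have "x \<in> generate G {x, y}" "y \<in> generate G {x, y}" by (simp_all add: generate.incl)
  then show ?thesis
    by (intro subgroup.m_closed[OF sub] subgroup_int_pow_closed[OF sub])
qed

section \<open>The automorphism group as a topological group\<close>

lemma Aut_mem: "F \<in> Aut n \<Longrightarrow> x \<in> chain_antichains n \<Longrightarrow> F x \<in> chain_antichains n"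
  unfolding Aut_def chain_iso_def by (auto dest: bij_betw_apply)

lemma Aut_less_iff:
  "F \<in> Aut n \<Longrightarrow> x \<in> chain_antichains n \<Longrightarrow> y \<in> chain_antichains n \<Longrightarrow>
    snd (F x) < snd (F y) \<longleftrightarrow> snd x < snd y"
  unfolding Aut_def chain_iso_def chain_less_def by auto

lemma Aut_inj_iff:
  "F \<in> Aut n \<Longrightarrow> x \<in> chain_antichains n \<Longrightarrow> y \<in> chain_antichains n \<Longrightarrow> F x = F y \<longleftrightarrow> x = y"
  unfolding Aut_def chain_iso_def bij_betw_def by (auto dest: inj_onD)

lemma Aut_subset_Bij: "Aut n \<subseteq> Bij (chain_antichains n)"
  unfolding Aut_def chain_iso_def Bij_def by auto

lemma Aut_eqI:
  assumes "F \<in> Aut n" "G \<in> Aut n" "\<And>x. x \<in> chain_antichains n \<Longrightarrow> F x = G x"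
  shows "F = G"
  using assms unfolding Aut_def by (auto intro: extensionalityI)

lemma carrier_Aut_group [simp]: "carrier (Aut_group n) = Aut n"
  by (simp add: Aut_group_def)

lemma subgroup_Aut: "subgroup (Aut n) (BijGroup (chain_antichains n))"
proof (rule group.subgroupI[OF group_BijGroup])
  let ?C = "chain_antichains n"
  show "Aut n \<subseteq> carrier (BijGroup ?C)"
    using Aut_subset_Bij by (simp add: BijGroup_def)
  have "(\<lambda>x\<in>?C. x) \<in> Aut n"
    by (auto simp: Aut_def chain_iso_def bij_betw_def inj_on_def)
  then show "Aut n \<noteq> {}" by auto
  fix F assume F: "F \<in> Aut n"
  then have B: "bij_betw F ?C ?C" and FB: "F \<in> Bij ?C"
    using Aut_subset_Bij by (auto simp: Aut_def chain_iso_def)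
  let ?I = "\<lambda>x\<in>?C. inv_into ?C F x"
  have I: "F (?I x) = x" "?I x \<in> ?C" if "x \<in> ?C" for x
    using that B by (auto simp: bij_betw_def f_inv_into_f inv_into_into)
  have "?I \<in> Bij ?C" using FB by (rule restrict_inv_into_Bij)
  then have Ib: "?I \<in> extensional ?C" "bij_betw ?I ?C ?C" by (auto simp: Bij_def)
  have "chain_less x y \<longleftrightarrow> chain_less (?I x) (?I y)" if "x \<in> ?C" "y \<in> ?C" for x y
    using Aut_less_iff[OF F I(2)[OF that(1)] I(2)[OF that(2)]]
    unfolding I(1)[OF that(1)] I(1)[OF that(2)] chain_less_def .
  then have "?I \<in> Aut n" using Ib unfolding Aut_def chain_iso_def by blast
  then show "inv\<^bsub>BijGroup ?C\<^esub> F \<in> Aut n" using FB by (simp add: inv_BijGroup)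
next
  let ?C = "chain_antichains n"
  fix F G assume FG: "F \<in> Aut n" "G \<in> Aut n"
  then have FGB: "F \<in> Bij ?C" "G \<in> Bij ?C" using Aut_subset_Bij by auto
  then have "compose ?C F G \<in> Bij ?C" by (rule compose_Bij)
  moreover have "chain_less x y \<longleftrightarrow> chain_less (compose ?C F G x) (compose ?C F G y)"
    if "x \<in> ?C" "y \<in> ?C" for x y
    using that Aut_less_iff[OF FG(1) Aut_mem[OF FG(2) that(1)] Aut_mem[OF FG(2) that(2)]]
      Aut_less_iff[OF FG(2) that] by (simp add: chain_less_def compose_eq)
  ultimately have "compose ?C F G \<in> Aut n" unfolding Aut_def chain_iso_def Bij_def by auto
  then show "F \<otimes>\<^bsub>BijGroup ?C\<^esub> G \<in> Aut n" using FGB by (simp add: BijGroup_def)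
qed

lemma group_Aut_group: "group (Aut_group n)"
  unfolding Aut_group_def by (rule group.subgroup_imp_group[OF group_BijGroup subgroup_Aut])

lemma mult_Aut_apply:
  "\<lbrakk>F \<in> Aut n; G \<in> Aut n; x \<in> chain_antichains n\<rbrakk> \<Longrightarrow> (F \<otimes>\<^bsub>Aut_group n\<^esub> G) x = F (G x)"
  using Aut_subset_Bij[of n] by (auto simp: Aut_group_def BijGroup_def compose_eq subset_iff)

lemma one_Aut_apply: "x \<in> chain_antichains n \<Longrightarrow> \<one>\<^bsub>Aut_group n\<^esub> x = x"
  by (simp add: Aut_group_def BijGroup_def)

lemma inv_Aut_apply:
  assumes "F \<in> Aut n" "x \<in> chain_antichains n"
  shows "(inv\<^bsub>Aut_group n\<^esub> F) (F x) = x" "F ((inv\<^bsub>Aut_group n\<^esub> F) x) = x"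
proof -
  have inv: "inv\<^bsub>Aut_group n\<^esub> F \<in> Aut n"
    using group.inv_closed[OF group_Aut_group, of F n] assms(1) by simp
  show "(inv\<^bsub>Aut_group n\<^esub> F) (F x) = x"
    using mult_Aut_apply[OF inv assms] group.l_inv[OF group_Aut_group, of F n] assms one_Aut_apply
    by simp
  show "F ((inv\<^bsub>Aut_group n\<^esub> F) x) = x"
    using mult_Aut_apply[OF assms(1) inv assms(2)] group.r_inv[OF group_Aut_group, of F n] assms
      one_Aut_apply
    by simp
qed

lemma topspace_Aut_topology [simp]: "topspace (Aut_topology n) = Aut n"
proof -
  have "Aut_basic_open n {} undefined = Aut n" by (simp add: Aut_basic_open_def)
  moreover have "Aut_basic_open n {} undefined \<in> Aut_basis n"
    unfolding Aut_basis_def by (auto simp: chain_iso_def bij_betw_def)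
  moreover have "U \<subseteq> Aut n" if "U \<in> Aut_basis n" for U
    using that unfolding Aut_basis_def Aut_basic_open_def by auto
  ultimately have "\<Union>(Aut_basis n) = Aut n" by blast
  then show ?thesis by (simp add: Aut_topology_def)
qed

lemma openin_Aut_value:
  assumes "x \<in> chain_antichains n"
  shows "openin (Aut_topology n) {F \<in> Aut n. F x = y}"
proof (cases "y \<in> chain_antichains n")
  case True
  then have "Aut_basic_open n {x} (\<lambda>_. y) \<in> Aut_basis n"
    unfolding Aut_basis_def using assms
    by (intro CollectI exI[of _ "{x}"] exI[of _ "{y}"] exI[of _ "\<lambda>_. y"])
      (auto simp: chain_iso_def bij_betw_def chain_less_def)
  then have "openin (Aut_topology n) (Aut_basic_open n {x} (\<lambda>_. y))"
    unfolding Aut_topology_def by (rule topology_generated_by_Basis)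
  then show ?thesis by (simp add: Aut_basic_open_def)
next
  case False
  then have "{F \<in> Aut n. F x = y} = {}" using Aut_mem assms by blast
  then show ?thesis by (simp only: openin_empty)
qed

text \<open>The next three lemmas turn membership in an open set into a finite condition; with several
  components, one finite set serves them all.\<close>

lemma Aut_neighbourhood:
  assumes "openin (Aut_topology n) U" "F \<in> U"
  obtains D where "finite D" "D \<subseteq> chain_antichains n"
    "\<And>F'. F' \<in> Aut n \<Longrightarrow> \<forall>x\<in>D. F' x = F x \<Longrightarrow> F' \<in> U"
proof -
  have "generate_topology_on (Aut_basis n) U"
    using assms(1) unfolding Aut_topology_def by (rule openin_topology_generated_by)
  then have "F \<in> U \<longrightarrow> (\<exists>D. finite D \<and> D \<subseteq> chain_antichains n \<and>
      (\<forall>F'\<in>Aut n. (\<forall>x\<in>D. F' x = F x) \<longrightarrow> F' \<in> U))"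
  proof (induction rule: generate_topology_on.induct)
    case Empty
    then show ?case by simp
  next
    case (Int U V)
    show ?case
    proof
      assume "F \<in> U \<inter> V"
      with Int obtain D E where DE: "finite D" "D \<subseteq> chain_antichains n" "finite E" "E \<subseteq> chain_antichains n"
        "\<forall>F'\<in>Aut n. (\<forall>x\<in>D. F' x = F x) \<longrightarrow> F' \<in> U" "\<forall>F'\<in>Aut n. (\<forall>x\<in>E. F' x = F x) \<longrightarrow> F' \<in> V"
        by auto
      then show "\<exists>D. finite D \<and> D \<subseteq> chain_antichains n \<and>
          (\<forall>F'\<in>Aut n. (\<forall>x\<in>D. F' x = F x) \<longrightarrow> F' \<in> U \<inter> V)"
        by (intro exI[of _ "D \<union> E"]) simp
    qed
  next
    case (UN K)
    show ?case
    proof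
      assume "F \<in> \<Union>K"
      then obtain V where V: "V \<in> K" "F \<in> V" by blast
      with UN.IH[OF V(1)] obtain D where "finite D" "D \<subseteq> chain_antichains n"
          "\<forall>F'\<in>Aut n. (\<forall>x\<in>D. F' x = F x) \<longrightarrow> F' \<in> V"
        by auto
      with V(1) show "\<exists>D. finite D \<and> D \<subseteq> chain_antichains n \<and>
          (\<forall>F'\<in>Aut n. (\<forall>x\<in>D. F' x = F x) \<longrightarrow> F' \<in> \<Union>K)"
        by (intro exI[of _ D]) auto
    qed
  next
    case (Basis U)
    show ?case
    proof
      assume "F \<in> U"
      from Basis obtain D f where "U = Aut_basic_open n D f" "finite D" "D \<subseteq> chain_antichains n"
        unfolding Aut_basis_def by auto
      with \<open>F \<in> U\<close> show "\<exists>D. finite D \<and> D \<subseteq> chain_antichains n \<and>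
          (\<forall>F'\<in>Aut n. (\<forall>x\<in>D. F' x = F x) \<longrightarrow> F' \<in> U)"
        by (intro exI[of _ D]) (simp add: Aut_basic_open_def)
    qed
  qed
  then show ?thesis using assms(2) that by auto
qed

lemma prod_Aut_neighbourhood:
  assumes "openin (prod_topology (subtopology (Aut_topology n) A) (Aut_topology n)) U" "(F, G) \<in> U"
  obtains D where "finite D" "D \<subseteq> chain_antichains n"
    "\<And>F' G'. \<lbrakk>F' \<in> Aut n; F' \<in> A; G' \<in> Aut n; \<forall>x\<in>D. F' x = F x; \<forall>x\<in>D. G' x = G x\<rbrakk> \<Longrightarrow> (F', G') \<in> U"
proof -
  obtain V W where V: "openin (subtopology (Aut_topology n) A) V"
    and W: "openin (Aut_topology n) W" "F \<in> V" "G \<in> W" "V \<times> W \<subseteq> U"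
    using assms unfolding openin_prod_topology_alt by (elim allE impE) auto
  obtain V' where V': "openin (Aut_topology n) V'" "V = V' \<inter> A"
    using V unfolding openin_subtopology by auto
  have "F \<in> V'" using W V' by auto
  obtain D where D: "finite D" "D \<subseteq> chain_antichains n"
      "\<And>F'. F' \<in> Aut n \<Longrightarrow> \<forall>x\<in>D. F' x = F x \<Longrightarrow> F' \<in> V'"
    by (rule Aut_neighbourhood[OF V'(1) \<open>F \<in> V'\<close>]) blast
  obtain E where E: "finite E" "E \<subseteq> chain_antichains n"
      "\<And>G'. G' \<in> Aut n \<Longrightarrow> \<forall>x\<in>E. G' x = G x \<Longrightarrow> G' \<in> W"
    by (rule Aut_neighbourhood[OF W(1,3)]) blast
  show ?thesis
  proof (rule that[of "D \<union> E"])
    fix F' G' assume "F' \<in> Aut n" "F' \<in> A" "G' \<in> Aut n"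
      "\<forall>x\<in>D \<union> E. F' x = F x" "\<forall>x\<in>D \<union> E. G' x = G x"
    then have "(F', G') \<in> V \<times> W" using D(3)[of F'] E(3)[of G'] V'(2) by simp
    then show "(F', G') \<in> U" using W(4) by blast
  qed (use D E in auto)
qed

lemma product_Aut_neighbourhood:
  assumes "openin (product_topology (\<lambda>_. Aut_topology n) I) U" "g \<in> U" and I: "finite I"
  obtains D where "finite D" "D \<subseteq> chain_antichains n"
    "\<And>g'. g' \<in> I \<rightarrow>\<^sub>E Aut n \<Longrightarrow> \<forall>i\<in>I. \<forall>x\<in>D. g' i x = g i x \<Longrightarrow> g' \<in> U"
proof -
  obtain V where V: "\<And>i. openin (Aut_topology n) (V i)" "g \<in> Pi\<^sub>E I V" "Pi\<^sub>E I V \<subseteq> U"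
    using product_topology_open_contains_basis[OF assms(1,2)] by auto
  have "\<forall>i\<in>I. \<exists>D. finite D \<and> D \<subseteq> chain_antichains n \<and>
      (\<forall>F'\<in>Aut n. (\<forall>x\<in>D. F' x = g i x) \<longrightarrow> F' \<in> V i)"
  proof
    fix i assume "i \<in> I"
    then have "g i \<in> V i" using V(2) by (rule PiE_mem[rotated])
    from Aut_neighbourhood[OF V(1) this] show "\<exists>D. finite D \<and> D \<subseteq> chain_antichains n \<and>
      (\<forall>F'\<in>Aut n. (\<forall>x\<in>D. F' x = g i x) \<longrightarrow> F' \<in> V i)" by metis
  qed
  then obtain D where D: "\<forall>i\<in>I. finite (D i) \<and> D i \<subseteq> chain_antichains n \<and>
      (\<forall>F'\<in>Aut n. (\<forall>x\<in>D i. F' x = g i x) \<longrightarrow> F' \<in> V i)"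
    by (rule bchoice[THEN exE])
  show ?thesis
  proof (rule that[of "\<Union>i\<in>I. D i"])
    fix g' assume g': "g' \<in> I \<rightarrow>\<^sub>E Aut n" "\<forall>i\<in>I. \<forall>x\<in>\<Union>i\<in>I. D i. g' i x = g i x"
    have "g' \<in> Pi\<^sub>E I V"
    proof (rule PiE_I)
      fix i assume "i \<in> I"
      then show "g' i \<in> V i" using D g' PiE_mem[OF g'(1)] by auto
    qed (rule PiE_arb[OF g'(1)])
    then show "g' \<in> U" using V(3) by blast
  qed (use D I in auto)
qed

text \<open>A finite condition is a finite subset of the graph, hence of a countable set.\<close>

lemma countable_pi_base_Aut: "\<exists>\<B>. countable_pi_base (Aut_topology n) \<B>"
proof -
  let ?C = "chain_antichains n"
  define cyl where "cyl P = {F \<in> Aut n. \<forall>z\<in>P. F (fst z) = snd z}"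
    for P :: "((nat \<times> rat) \<times> (nat \<times> rat)) set"
  define \<B> where "\<B> = cyl ` {P. finite P \<and> fst ` P \<subseteq> ?C} - {{}}"
  have "countable {P :: ((nat \<times> rat) \<times> (nat \<times> rat)) set. finite P \<and> fst ` P \<subseteq> ?C}"
    by (rule countable_subset[OF _ countable_Collect_finite]) auto
  then have "countable \<B>" unfolding \<B>_def by (intro countable_Diff countable_image)
  moreover have "openin (Aut_topology n) (cyl P)" if P: "finite P" "fst ` P \<subseteq> ?C" for P
  proof -
    have "openin (Aut_topology n) ((\<Inter>z\<in>P. {F \<in> Aut n. F (fst z) = snd z}) \<inter> topspace (Aut_topology n))"
      using P by (intro openin_INT openin_Aut_value) auto
    moreover have "(\<Inter>z\<in>P. {F \<in> Aut n. F (fst z) = snd z}) \<inter> topspace (Aut_topology n) = cyl P"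
      by (auto simp: cyl_def)
    ultimately show ?thesis by simp
  qed
  then have "\<forall>B\<in>\<B>. openin (Aut_topology n) B \<and> B \<noteq> {}" by (auto simp: \<B>_def)
  moreover have "\<exists>B\<in>\<B>. B \<subseteq> U" if U: "openin (Aut_topology n) U" "U \<noteq> {}" for U
  proof -
    obtain F where F: "F \<in> U" using U(2) by blast
    then have "F \<in> Aut n" using openin_subset[OF U(1)] by auto
    obtain D where D: "finite D" "D \<subseteq> ?C"
        "\<And>F'. F' \<in> Aut n \<Longrightarrow> \<forall>x\<in>D. F' x = F x \<Longrightarrow> F' \<in> U"
      by (rule Aut_neighbourhood[OF U(1) F]) blast
    let ?P = "(\<lambda>x. (x, F x)) ` D"
    have "F \<in> cyl ?P" using \<open>F \<in> Aut n\<close> by (simp add: cyl_def)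
    moreover have "finite ?P" "fst ` ?P \<subseteq> ?C" using D(1,2) by auto
    ultimately have "cyl ?P \<in> \<B>" unfolding \<B>_def by auto
    moreover have "cyl ?P \<subseteq> U" using D(3) by (auto simp: cyl_def)
    ultimately show ?thesis by blast
  qed
  ultimately show ?thesis unfolding countable_pi_base_def by auto
qed

text \<open>The topology is that of pointwise convergence into a discrete space, so continuity can be tested
  one value at a time.\<close>

lemma continuous_map_into_Aut:
  assumes f: "\<And>p. p \<in> topspace X \<Longrightarrow> f p \<in> Aut n"
    and op: "\<And>x y. x \<in> chain_antichains n \<Longrightarrow> openin X {p \<in> topspace X. f p x = y}"
  shows "continuous_map X (Aut_topology n) f"
proof -
  have "openin X (f -` U \<inter> topspace X)" if "U \<in> Aut_basis n" for U
  proof -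
    from that obtain D g where U: "U = Aut_basic_open n D g" "finite D" "D \<subseteq> chain_antichains n"
      unfolding Aut_basis_def by auto
    have "openin X ((\<Inter>x\<in>D. {p \<in> topspace X. f p x = g x}) \<inter> topspace X)"
      by (intro openin_INT ballI op) (use U in auto)
    moreover have "(\<Inter>x\<in>D. {p \<in> topspace X. f p x = g x}) \<inter> topspace X = f -` U \<inter> topspace X"
      using f by (auto simp: U(1) Aut_basic_open_def)
    ultimately show ?thesis by simp
  qed
  moreover have "f ` topspace X \<subseteq> \<Union>(Aut_basis n)"
    using f topspace_Aut_topology[of n] by (auto simp: Aut_topology_def)
  ultimately show ?thesis
    unfolding Aut_topology_def continuous_on_generated_topo_iff by blast
qed

lemma continuous_map_Aut_value:
  assumes "continuous_map X (Aut_topology n) f" "x \<in> chain_antichains n"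
  shows "openin X {p \<in> topspace X. f p x = y}"
proof -
  have "openin X {p \<in> topspace X. f p \<in> {F \<in> Aut n. F x = y}}"
    by (rule openin_continuous_map_preimage[OF assms(1) openin_Aut_value[OF assms(2)]])
  moreover have "{p \<in> topspace X. f p \<in> {F \<in> Aut n. F x = y}} = {p \<in> topspace X. f p x = y}"
    using continuous_map_image_subset_topspace[OF assms(1)] by auto
  ultimately show ?thesis by simp
qed

lemma continuous_map_Aut_mem:
  "continuous_map X (Aut_topology n) f \<Longrightarrow> p \<in> topspace X \<Longrightarrow> f p \<in> Aut n"
  using continuous_map_image_subset_topspace by fastforce

lemma continuous_map_Aut_mult:
  assumes f: "continuous_map X (Aut_topology n) f" and g: "continuous_map X (Aut_topology n) g"
  shows "continuous_map X (Aut_topology n) (\<lambda>p. f p \<otimes>\<^bsub>Aut_group n\<^esub> g p)"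
proof (rule continuous_map_into_Aut)
  interpret group "Aut_group n" by (rule group_Aut_group)
  note mem = continuous_map_Aut_mem[OF f] continuous_map_Aut_mem[OF g]
  show "f p \<otimes>\<^bsub>Aut_group n\<^esub> g p \<in> Aut n" if "p \<in> topspace X" for p
    using m_closed mem that by simp
  fix x y assume x: "x \<in> chain_antichains n"
  have "openin X (\<Union>z\<in>chain_antichains n. {p \<in> topspace X. f p z = y} \<inter> {p \<in> topspace X. g p x = z})"
    by (intro openin_clauses(3) openin_Union ballI)
      (auto intro!: openin_Int continuous_map_Aut_value f g x)
  moreover have "(\<Union>z\<in>chain_antichains n. {p \<in> topspace X. f p z = y} \<inter> {p \<in> topspace X. g p x = z})
      = {p \<in> topspace X. (f p \<otimes>\<^bsub>Aut_group n\<^esub> g p) x = y}"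
    using mem x Aut_mem[OF mem(2) x] by (auto simp: mult_Aut_apply)
  ultimately show "openin X {p \<in> topspace X. (f p \<otimes>\<^bsub>Aut_group n\<^esub> g p) x = y}" by simp
qed

lemma continuous_map_Aut_inv:
  assumes f: "continuous_map X (Aut_topology n) f"
  shows "continuous_map X (Aut_topology n) (\<lambda>p. inv\<^bsub>Aut_group n\<^esub> f p)"
proof (rule continuous_map_into_Aut)
  interpret group "Aut_group n" by (rule group_Aut_group)
  note mem = continuous_map_Aut_mem[OF f]
  have inv: "inv\<^bsub>Aut_group n\<^esub> f p \<in> Aut n" if "p \<in> topspace X" for p
    using inv_closed mem that by simp
  then show "inv\<^bsub>Aut_group n\<^esub> f p \<in> Aut n" if "p \<in> topspace X" for p using that .
  fix x y assume x: "x \<in> chain_antichains n"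
  show "openin X {p \<in> topspace X. (inv\<^bsub>Aut_group n\<^esub> f p) x = y}"
  proof (cases "y \<in> chain_antichains n")
    case True
    then have "{p \<in> topspace X. (inv\<^bsub>Aut_group n\<^esub> f p) x = y} = {p \<in> topspace X. f p y = x}"
      using mem x by (auto simp: inv_Aut_apply)
    then show ?thesis using continuous_map_Aut_value[OF f True] by simp
  next
    case False
    then have "{p \<in> topspace X. (inv\<^bsub>Aut_group n\<^esub> f p) x = y} = {}"
      using Aut_mem[OF inv x] by blast
    then show ?thesis by (simp only: openin_empty)
  qed
qed

lemma continuous_map_Aut_const:
  "F \<in> Aut n \<Longrightarrow> continuous_map X (Aut_topology n) (\<lambda>_. F)"
  by simp

lemma continuous_map_Aut_int_pow:
  fixes k :: int
  assumes f: "continuous_map X (Aut_topology n) f"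
  shows "continuous_map X (Aut_topology n) (\<lambda>p. f p [^]\<^bsub>Aut_group n\<^esub> k)"
proof -
  interpret group "Aut_group n" by (rule group_Aut_group)
  have one: "\<one>\<^bsub>Aut_group n\<^esub> \<in> Aut n" using one_closed by simp
  have nat: "continuous_map X (Aut_topology n) (\<lambda>p. f p [^]\<^bsub>Aut_group n\<^esub> j)" for j :: nat
  proof (induction j)
    case 0
    then show ?case using one by simp
  next
    case (Suc j)
    then show ?case using continuous_map_Aut_mult[OF Suc f] by simp
  qed
  show ?thesis
    unfolding int_pow_def2 by (cases "k < 0") (simp_all only: if_True if_False nat continuous_map_Aut_inv)
qed

lemma continuous_map_Aut_eval_word:
  assumes f: "continuous_map X (Aut_topology n) f" and g: "continuous_map X (Aut_topology n) g"
  shows "continuous_map X (Aut_topology n) (\<lambda>p. eval_word (Aut_group n) (f p) (g p) w)"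
proof (induction w)
  case Nil
  have "\<one>\<^bsub>Aut_group n\<^esub> \<in> Aut n"
    using monoid.one_closed[OF group.is_monoid[OF group_Aut_group]] by simp
  then show ?case by (simp add: eval_word_def)
next
  case (Cons ck w)
  obtain c k where ck: "ck = (c, k)" by (cases ck)
  have "continuous_map X (Aut_topology n) (\<lambda>p. eval_letter (f p) (g p) c)"
    by (cases c) (simp_all add: f g)
  from continuous_map_Aut_mult[OF continuous_map_Aut_int_pow[OF this, of k] Cons]
  show ?case by (simp add: eval_word_def ck)
qed

section \<open>Pushing a finite condition out of the way\<close>

text \<open>Being in \<^const>\<open>Aut_plus\<close> does not force the iterates at a point to be unbounded: they may
  accumulate at an irrational number. A uniform bound on the displacement excludes this.\<close>

definition uniformly_increasing :: "enat \<Rightarrow> (nat \<times> rat \<Rightarrow> nat \<times> rat) \<Rightarrow> bool" where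
  "uniformly_increasing n F \<longleftrightarrow>
     F \<in> Aut n \<and> (\<exists>\<delta>>0. \<forall>x\<in>chain_antichains n. snd x + \<delta> \<le> snd (F x))"

lemma uniformly_increasing_imp_Aut_plus: "uniformly_increasing n F \<Longrightarrow> F \<in> Aut_plus n"
  unfolding uniformly_increasing_def Aut_plus_def by force

text \<open>If one finite condition lies completely below another, their union is again a finite partial
  isomorphism. Positivity on the finitely many points of the conditions is automatically uniform,
  which is why the glued automorphism can be chosen uniformly increasing. For empty \<open>E\<close> this shows
  that the uniformly increasing automorphisms are dense in \<^const>\<open>Aut_plus\<close>.\<close>

lemma glue_automorphisms:
  assumes A: "A \<in> Aut n" "B \<in> Aut n"
    and D: "finite D" "D \<subseteq> chain_antichains n" and E: "finite E" "E \<subseteq> chain_antichains n"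
    and below: "\<And>x y. x \<in> D \<Longrightarrow> y \<in> E \<Longrightarrow> snd x < snd y \<and> snd (A x) < snd (B y)"
  shows "\<exists>F\<in>Aut n. (\<forall>x\<in>D. F x = A x) \<and> (\<forall>y\<in>E. F y = B y) \<and>
    (A \<in> Aut_plus n \<longrightarrow> B \<in> Aut_plus n \<longrightarrow> uniformly_increasing n F)"
proof -
  let ?C = "chain_antichains n"
  define f where "f x = (if x \<in> D then A x else B x)" for x
  have fD: "f x = A x" if "x \<in> D" for x using that by (simp add: f_def)
  have fE: "f y = B y" if "y \<in> E" for y using that below[of y y] by (auto simp: f_def)
  have less: "snd (f x) < snd (f y) \<longleftrightarrow> snd x < snd y" if xy: "x \<in> D \<union> E" "y \<in> D \<union> E" for x y
  proof -
    consider "x \<in> D" "y \<in> D" | "x \<in> D" "y \<in> E" | "x \<in> E" "y \<in> D" | "x \<in> E" "y \<in> E"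
      using xy by blast
    then show ?thesis
    proof cases
      case 1
      then show ?thesis using Aut_less_iff[OF A(1), of x y] D by (auto simp: fD)
    next
      case 2
      then show ?thesis using below[of x y] by (simp add: fD fE)
    next
      case 3
      then show ?thesis using below[of y x] by (simp add: fD fE)
    next
      case 4
      then show ?thesis using Aut_less_iff[OF A(2), of x y] E by (auto simp: fE)
    qed
  qed
  have "inj_on f (D \<union> E)"
  proof (rule inj_onI)
    fix x y assume xy: "x \<in> D \<union> E" "y \<in> D \<union> E" "f x = f y"
    then consider "x \<in> D" "y \<in> D" | "x \<in> D" "y \<in> E" | "x \<in> E" "y \<in> D" | "x \<in> E" "y \<in> E"
      by blast
    then show "x = y"
    proof cases
      case 1
      then show ?thesis using Aut_inj_iff[OF A(1), of x y] D xy(3) by (auto simp: fD)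
    next
      case 2
      then show ?thesis using below[of x y] xy(3) by (simp add: fD fE)
    next
      case 3
      then show ?thesis using below[of y x] xy(3) by (simp add: fD fE)
    next
      case 4
      then show ?thesis using Aut_inj_iff[OF A(2), of x y] E xy(3) by (auto simp: fE)
    qed
  qed
  then have iso: "chain_iso (D \<union> E) (f ` (D \<union> E)) f"
    using less by (auto simp: chain_iso_def chain_less_def bij_betw_def)
  have fC: "f ` (D \<union> E) \<subseteq> ?C"
    using Aut_mem[OF A(1)] Aut_mem[OF A(2)] D E fD fE by auto
  \<comment> \<open>The extra element covers the case that both sets are empty.\<close>
  define \<delta> where "\<delta> = Min (insert 1 ((\<lambda>x. snd (f x) - snd x) ` (D \<union> E)))"
  have \<delta>: "\<delta> \<le> snd (f x) - snd x" if "x \<in> D \<union> E" for x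
    unfolding \<delta>_def using D(1) E(1) that by (intro Min_le) auto
  obtain F where F: "F \<in> Aut n" "\<forall>x\<in>D \<union> E. F x = f x"
      "(\<forall>x\<in>D \<union> E. snd x + \<delta> \<le> snd (f x)) \<longrightarrow> (\<forall>x\<in>?C. snd x + \<delta> \<le> snd (F x))"
    using finite_partial_isomorphism_extends[OF _ _ fC iso, of \<delta>] D E by auto
  have "uniformly_increasing n F" if "A \<in> Aut_plus n" "B \<in> Aut_plus n"
  proof -
    have "0 < snd (f x) - snd x" if x: "x \<in> D \<union> E" for x
    proof (cases "x \<in> D")
      case True
      then show ?thesis using \<open>A \<in> Aut_plus n\<close> D(2) fD[OF True] by (auto simp: Aut_plus_def)
    next
      case False
      then have "x \<in> E" using x by blast
      then show ?thesis using \<open>B \<in> Aut_plus n\<close> E(2) fE[of x] by (auto simp: Aut_plus_def)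
    qed
    then have "\<delta> > 0" unfolding \<delta>_def using D(1) E(1) by (subst Min_gr_iff) auto
    moreover have "\<forall>x\<in>D \<union> E. snd x + \<delta> \<le> snd (f x)"
      using \<delta> by (metis add.commute le_diff_eq)
    with F(3) have "\<forall>x\<in>?C. snd x + \<delta> \<le> snd (F x)" by (rule mp)
    ultimately show ?thesis using F(1) unfolding uniformly_increasing_def by auto
  qed
  then show ?thesis using F(1,2) fD fE by (intro bexI[of _ F]) auto
qed

lemma uniformly_increasing_pow:
  assumes K: "K \<in> Aut n" and \<delta>: "\<And>x. x \<in> chain_antichains n \<Longrightarrow> snd x + \<delta> \<le> snd (K x)"
    and x: "x \<in> chain_antichains n"
  shows "snd x + of_nat k * \<delta> \<le> snd ((K [^]\<^bsub>Aut_group n\<^esub> k) x)"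
  using x
proof (induction k arbitrary: x)
  case 0
  then show ?case by (simp add: one_Aut_apply)
next
  case (Suc k)
  have P: "K [^]\<^bsub>Aut_group n\<^esub> k \<in> Aut n"
    using monoid.nat_pow_closed[OF group.is_monoid[OF group_Aut_group], of K n k] K by simp
  have "snd x + \<delta> + of_nat k * \<delta> \<le> snd (K x) + of_nat k * \<delta>"
    using \<delta>[OF Suc.prems] by simp
  also have "\<dots> \<le> snd ((K [^]\<^bsub>Aut_group n\<^esub> k) (K x))"
    by (rule Suc.IH[OF Aut_mem[OF K Suc.prems]])
  also have "\<dots> = snd ((K [^]\<^bsub>Aut_group n\<^esub> Suc k) x)"
    using mult_Aut_apply[OF P K Suc.prems] by simp
  finally show ?case by (simp add: algebra_simps)
qed

lemma conj_Aut_plus: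
  assumes P: "P \<in> Aut n" and H: "H \<in> Aut_plus n"
  shows "P \<otimes>\<^bsub>Aut_group n\<^esub> H \<otimes>\<^bsub>Aut_group n\<^esub> inv\<^bsub>Aut_group n\<^esub> P \<in> Aut_plus n"
proof -
  interpret group "Aut_group n" by (rule group_Aut_group)
  have H': "H \<in> Aut n" "\<And>x. x \<in> chain_antichains n \<Longrightarrow> snd x < snd (H x)"
    using H by (auto simp: Aut_plus_def)
  have mem: "inv\<^bsub>Aut_group n\<^esub> P \<in> Aut n" "P \<otimes>\<^bsub>Aut_group n\<^esub> H \<in> Aut n"
      "P \<otimes>\<^bsub>Aut_group n\<^esub> H \<otimes>\<^bsub>Aut_group n\<^esub> inv\<^bsub>Aut_group n\<^esub> P \<in> Aut n"
    using P H'(1) inv_closed[of P] m_closed[of P H] m_closed[of "P \<otimes>\<^bsub>Aut_group n\<^esub> H"] by simp_all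
  have "snd x < snd ((P \<otimes>\<^bsub>Aut_group n\<^esub> H \<otimes>\<^bsub>Aut_group n\<^esub> inv\<^bsub>Aut_group n\<^esub> P) x)"
    if x: "x \<in> chain_antichains n" for x
  proof -
    let ?z = "(inv\<^bsub>Aut_group n\<^esub> P) x"
    have z: "?z \<in> chain_antichains n" using Aut_mem[OF mem(1) x] .
    have "snd (P ?z) < snd (P (H ?z))"
      using Aut_less_iff[OF P z Aut_mem[OF H'(1) z]] H'(2)[OF z] by blast
    then show ?thesis
      using mult_Aut_apply[OF mem(2,1) x] mult_Aut_apply[OF P H'(1) z] inv_Aut_apply(2)[OF P x]
      by simp
  qed
  then show ?thesis using mem(3) by (simp add: Aut_plus_def)
qed

text \<open>The source of all density statements. Requiring \<open>K\<^sup>k F K\<^sup>-\<^sup>k\<close> to agree with \<open>H\<close> on \<open>Y\<close> amounts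
  to requiring \<open>F\<close> to agree with \<open>K\<^sup>-\<^sup>k H K\<^sup>k\<close> on \<open>K\<^sup>-\<^sup>k Y\<close>. For very negative \<open>k\<close> this second
  condition lies above the condition on \<open>D\<close>, and the two can be glued. Every sufficiently small \<open>k\<close> is
  admitted, so that finitely many instances can be satisfied with the same \<open>k\<close>.\<close>

theorem conjugates_transitive:
  assumes K: "uniformly_increasing n K" and A: "A \<in> Aut n" and H: "H \<in> Aut n"
    and D: "finite D" "D \<subseteq> chain_antichains n" and Y: "finite Y" "Y \<subseteq> chain_antichains n"
  shows "\<exists>k0::int. \<forall>k\<le>k0. \<exists>F\<in>Aut n. (\<forall>x\<in>D. F x = A x) \<and>
    (\<forall>y\<in>Y. (K [^]\<^bsub>Aut_group n\<^esub> k \<otimes>\<^bsub>Aut_group n\<^esub> F \<otimes>\<^bsub>Aut_group n\<^esub> K [^]\<^bsub>Aut_group n\<^esub> (- k)) y = H y) \<and>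
    (A \<in> Aut_plus n \<longrightarrow> H \<in> Aut_plus n \<longrightarrow> uniformly_increasing n F)"
proof -
  interpret group "Aut_group n" by (rule group_Aut_group)
  let ?C = "chain_antichains n"
  obtain \<delta> where KA: "K \<in> Aut n" and \<delta>: "\<delta> > 0" "\<And>x. x \<in> ?C \<Longrightarrow> snd x + \<delta> \<le> snd (K x)"
    using K unfolding uniformly_increasing_def by auto
  define M where "M = Max (insert 0 (snd ` (D \<union> A ` D)))"
  define L where "L = Min (insert 0 (snd ` (Y \<union> H ` Y)))"
  have M: "snd x \<le> M" if "x \<in> D \<union> A ` D" for x
    unfolding M_def using D(1) that by (intro Max_ge) auto
  have L: "L \<le> snd y" if "y \<in> Y \<union> H ` Y" for y
    unfolding L_def using Y(1) that by (intro Min_le) auto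
  \<comment> \<open>After \<open>j\<close> applications of \<open>K\<close>, everything at or above \<open>L\<close> has moved above \<open>M\<close>.\<close>
  obtain j where j: "M - L < of_nat j * \<delta>"
    using ex_less_of_nat_mult[OF \<delta>(1)] by blast
  have "\<exists>F\<in>Aut n. (\<forall>x\<in>D. F x = A x) \<and>
    (\<forall>y\<in>Y. (K [^]\<^bsub>Aut_group n\<^esub> k \<otimes>\<^bsub>Aut_group n\<^esub> F \<otimes>\<^bsub>Aut_group n\<^esub> K [^]\<^bsub>Aut_group n\<^esub> (- k)) y = H y) \<and>
    (A \<in> Aut_plus n \<longrightarrow> H \<in> Aut_plus n \<longrightarrow> uniformly_increasing n F)" if k: "k \<le> - int j" for k
  proof -
    define i where "i = nat (- k)"
    have i: "- k = int i" "j \<le> i" using k by (simp_all add: i_def)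
    define P where "P = K [^]\<^bsub>Aut_group n\<^esub> (- k)"
    have P: "P \<in> Aut n" using int_pow_closed[of K "- k"] KA by (simp add: P_def)
    have Kk: "K [^]\<^bsub>Aut_group n\<^esub> k = inv\<^bsub>Aut_group n\<^esub> P"
      using int_pow_neg[of K "- k"] KA by (simp add: P_def)
    have iP: "inv\<^bsub>Aut_group n\<^esub> P \<in> Aut n" using inv_closed[of P] P by simp
    have far: "M < snd (P y)" if "y \<in> ?C" "L \<le> snd y" for y
    proof -
      have "snd y + of_nat i * \<delta> \<le> snd (P y)"
        using uniformly_increasing_pow[OF KA \<delta>(2) that(1), of i] i(1) by (simp add: P_def int_pow_int)
      moreover have "of_nat j * \<delta> \<le> of_nat i * \<delta>" using i(2) \<delta>(1) by (simp add: mult_right_mono)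
      ultimately show ?thesis using j that(2) by linarith
    qed
    let ?B = "P \<otimes>\<^bsub>Aut_group n\<^esub> H \<otimes>\<^bsub>Aut_group n\<^esub> inv\<^bsub>Aut_group n\<^esub> P"
    have PH: "P \<otimes>\<^bsub>Aut_group n\<^esub> H \<in> Aut n" using m_closed[of P H] P H by simp
    have B: "?B \<in> Aut n" using m_closed[OF _ inv_closed[of P]] PH P by simp
    have BP: "?B (P y) = P (H y)" if "y \<in> ?C" for y
      using that P PH H iP Aut_mem[OF P that] inv_Aut_apply(1)[OF P that]
      by (simp add: mult_Aut_apply)
    have PY: "P ` Y \<subseteq> ?C" using Aut_mem[OF P] Y(2) by auto
    have "snd x < snd z \<and> snd (A x) < snd (?B z)" if x: "x \<in> D" and z: "z \<in> P ` Y" for x z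
    proof -
      obtain y where y: "y \<in> Y" "z = P y" using z by blast
      have yC: "y \<in> ?C" using Y(2) y(1) by blast
      note HyC = Aut_mem[OF H yC]
      have "M < snd (P y)" "M < snd (P (H y))"
        using far[OF yC] far[OF HyC] L y(1) by auto
      moreover have "snd x \<le> M" "snd (A x) \<le> M" using M x by auto
      ultimately show ?thesis using BP[OF yC] y(2) by simp
    qed
    from glue_automorphisms[OF A B D _ PY this] Y(1)
    obtain F where F: "F \<in> Aut n" "\<forall>x\<in>D. F x = A x" "\<forall>z\<in>P ` Y. F z = ?B z"
        "A \<in> Aut_plus n \<longrightarrow> ?B \<in> Aut_plus n \<longrightarrow> uniformly_increasing n F"
      by auto
    have iPF: "inv\<^bsub>Aut_group n\<^esub> P \<otimes>\<^bsub>Aut_group n\<^esub> F \<in> Aut n" using m_closed[OF inv_closed[of P], of F] P F(1) by simp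
    have "(inv\<^bsub>Aut_group n\<^esub> P \<otimes>\<^bsub>Aut_group n\<^esub> F \<otimes>\<^bsub>Aut_group n\<^esub> P) y = H y" if y: "y \<in> Y" for y
    proof -
      have yC: "y \<in> ?C" using Y(2) y by blast
      have "F (P y) = P (H y)" using F(3) y BP[OF yC] by auto
      then show ?thesis
        using yC P F(1) iP iPF Aut_mem[OF P yC] inv_Aut_apply(1)[OF P Aut_mem[OF H yC]]
        by (simp add: mult_Aut_apply)
    qed
    then have "\<forall>y\<in>Y. (K [^]\<^bsub>Aut_group n\<^esub> k \<otimes>\<^bsub>Aut_group n\<^esub> F \<otimes>\<^bsub>Aut_group n\<^esub> K [^]\<^bsub>Aut_group n\<^esub> (- k)) y = H y"
      unfolding Kk P_def[symmetric] by blast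
    moreover have "A \<in> Aut_plus n \<longrightarrow> H \<in> Aut_plus n \<longrightarrow> uniformly_increasing n F"
      using F(4) conj_Aut_plus[OF P] by blast
    ultimately show ?thesis using F(1,2) by (intro bexI[of _ F] conjI)
  qed
  then show ?thesis by (intro exI[of _ "- int j"] allI impI)
qed

definition translation :: "enat \<Rightarrow> nat \<times> rat \<Rightarrow> nat \<times> rat" where
  "translation n = (\<lambda>x\<in>chain_antichains n. (fst x, snd x + 1))"

lemma Aut_of_order_bijection:
  assumes "strict_mono \<phi>" "surj \<phi>"
  shows "(\<lambda>x\<in>chain_antichains n. (fst x, \<phi> (snd x))) \<in> Aut n"
  using Aut_fibrewise[of "\<lambda>_ k. k" n \<phi>] assms by (simp add: bij_betw_def)

lemma uniformly_increasing_translation: "uniformly_increasing n (translation n)"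
proof -
  have "translation n \<in> Aut n"
    unfolding translation_def using affine_order_bijection[of "1::rat" 1 0]
    by (intro Aut_of_order_bijection) (simp_all add: add.commute)
  then show ?thesis unfolding uniformly_increasing_def
    by (intro conjI exI[of _ 1]) (auto simp: translation_def)
qed

section \<open>A free pair by ping-pong\<close>

text \<open>The values of \<open>cls\<close> label disjoint regions: \<open>E\<close> throws every point outside of the region \<open>z\<close>
  into the region \<open>z'\<close>, which is itself outside of \<open>z\<close>, so the powers of \<open>E\<close> do the same.\<close>

lemma group_pow_ping:
  fixes cls :: "nat \<times> rat \<Rightarrow> 'z" and k :: nat
  assumes E: "E \<in> Aut n" and z: "z \<noteq> z'"
    and ping: "\<And>x. x \<in> chain_antichains n \<Longrightarrow> cls x \<noteq> z \<Longrightarrow> cls (E x) = z'"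
    and k: "k > 0" and x: "x \<in> chain_antichains n" "cls x \<noteq> z"
  shows "cls ((E [^]\<^bsub>Aut_group n\<^esub> k) x) = z'"
  using k x
proof (induction k arbitrary: x)
  case (Suc k)
  have P: "E [^]\<^bsub>Aut_group n\<^esub> k \<in> Aut n"
    using monoid.nat_pow_closed[OF group.is_monoid[OF group_Aut_group], of E n k] E by simp
  have Ex: "cls (E x) = z'" "E x \<in> chain_antichains n"
    using ping Suc.prems Aut_mem[OF E] by auto
  have "(E [^]\<^bsub>Aut_group n\<^esub> Suc k) x = (E [^]\<^bsub>Aut_group n\<^esub> k) (E x)"
    using mult_Aut_apply[OF P E Suc.prems(2)] by simp
  moreover have "cls ((E [^]\<^bsub>Aut_group n\<^esub> k) (E x)) = z'"
  proof (cases "k = 0")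
    case True
    then show ?thesis using Ex one_Aut_apply[OF Ex(2)] by simp
  next
    case False
    then show ?thesis using Suc.IH[of "E x"] Ex z by simp
  qed
  ultimately show ?case by simp
qed simp

text \<open>Regions are indexed by signs: \<open>zone True\<close> attracts under positive powers, \<open>zone False\<close> under
  negative ones. That the inverse plays the mirrored game is the contrapositive of the
  assumption on \<open>E\<close>.\<close>

lemma group_int_pow_ping:
  fixes cls :: "nat \<times> rat \<Rightarrow> 'z" and zone :: "bool \<Rightarrow> 'z" and k :: int
  assumes E: "E \<in> Aut n" and z: "zone False \<noteq> zone True"
    and ping: "\<And>x. x \<in> chain_antichains n \<Longrightarrow> cls x \<noteq> zone False \<Longrightarrow> cls (E x) = zone True"
    and k: "k \<noteq> 0" and x: "x \<in> chain_antichains n" "cls x \<noteq> zone (k < 0)"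
  shows "cls ((E [^]\<^bsub>Aut_group n\<^esub> k) x) = zone (k > 0)"
proof (cases "k > 0")
  case True
  then have "E [^]\<^bsub>Aut_group n\<^esub> k = E [^]\<^bsub>Aut_group n\<^esub> nat k"
    unfolding int_pow_def2 by simp
  moreover have "cls ((E [^]\<^bsub>Aut_group n\<^esub> nat k) x) = zone True"
    by (rule group_pow_ping[where z = "zone False" and cls = cls, OF E z ping]) (use True x in auto)
  ultimately show ?thesis using True by simp
next
  case False
  interpret group "Aut_group n" by (rule group_Aut_group)
  let ?I = "inv\<^bsub>Aut_group n\<^esub> E"
  have I: "?I \<in> Aut n" using inv_closed[of E] E by simp
  have pong: "cls (?I y) = zone False" if y: "y \<in> chain_antichains n" "cls y \<noteq> zone True" for y
  proof (rule ccontr)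
    assume "cls (?I y) \<noteq> zone False"
    from ping[OF Aut_mem[OF I y(1)] this] show False
      using inv_Aut_apply(2)[OF E y(1)] y(2) by simp
  qed
  have "E [^]\<^bsub>Aut_group n\<^esub> k = ?I [^]\<^bsub>Aut_group n\<^esub> nat (- k)"
    using False k nat_pow_inv[of E "nat (- k)"] E unfolding int_pow_def2 by simp
  moreover have "cls ((?I [^]\<^bsub>Aut_group n\<^esub> nat (- k)) x) = zone False"
    by (rule group_pow_ping[where z = "zone True" and cls = cls, OF I z[symmetric] pong]) (use False k x in auto)
  ultimately show ?thesis using False by simp
qed

text \<open>Every syllable sends the current point into the attracting region of its letter and sign. As
  neighbouring syllables have different letters, this region is not the repelling one of the
  syllable that acts next.\<close>

lemma eval_word_ping_pong:
  fixes cls :: "nat \<times> rat \<Rightarrow> 'z" and zone :: "letter \<Rightarrow> bool \<Rightarrow> 'z"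
  assumes E: "\<And>c. eval_letter F G c \<in> Aut n"
    and z: "\<And>c s d t. zone c s = zone d t \<longleftrightarrow> c = d \<and> s = t"
    and ping: "\<And>c x. x \<in> chain_antichains n \<Longrightarrow> cls x \<noteq> zone c False \<Longrightarrow>
      cls (eval_letter F G c x) = zone c True"
    and w: "irreducible_word w" and x: "x \<in> chain_antichains n"
    and out: "cls x \<noteq> zone (fst (last w)) (snd (last w) < 0)"
  shows "cls (eval_word (Aut_group n) F G w x) = zone (fst (hd w)) (snd (hd w) > 0)"
  using w out
proof (induction w)
  case Nil
  then show ?case by (simp add: irreducible_word_def)
next
  case (Cons a w)
  obtain c k where a: "a = (c, k)" by (cases a)
  have FG: "F \<in> Aut n" "G \<in> Aut n" using E[of LetterA] E[of LetterB] by simp_all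
  have k: "k \<noteq> 0" using Cons.prems(1) by (auto simp: irreducible_word_def a)
  let ?w = "eval_word (Aut_group n) F G w" and ?P = "eval_letter F G c [^]\<^bsub>Aut_group n\<^esub> k"
  have w: "?w \<in> Aut n" using group.eval_word_closed[OF group_Aut_group, of F n G w] FG by simp
  have P: "?P \<in> Aut n" using group.int_pow_closed[OF group_Aut_group, of "eval_letter F G c" n k] E by simp
  have step: "eval_word (Aut_group n) F G (a # w) x = ?P (?w x)"
    using mult_Aut_apply[OF P w x] by (simp add: eval_word_def a)
  have "cls (?w x) \<noteq> zone c (k < 0)"
  proof (cases "w = []")
    case True
    then show ?thesis using Cons.prems(2) one_Aut_apply[OF x] by (simp add: eval_word_def a)
  next
    case False
    have "irreducible_word w" "c \<noteq> fst (hd w)"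
      using Cons.prems(1) False by (cases w; auto simp: irreducible_word_def a)+
    then show ?thesis using Cons.IH Cons.prems(2) False z by simp
  qed
  then have "cls (?P (?w x)) = zone c (k > 0)"
    using group_int_pow_ping[of "eval_letter F G c" n "zone c" cls k "?w x", OF E _ ping k Aut_mem[OF w x]] z
    by simp
  then show ?case using step by (simp add: a)
qed

text \<open>A piecewise linear lift to the line of a hyperbolic map of the circle of length 4, shifted by one
  full turn so that it moves all points upwards: modulo 4 it contracts \<open>[1, 4)\<close> onto \<open>[2, 3)\<close> and
  expands \<open>[0, 1)\<close> over the rest. Its conjugate by the translation by 1 uses the remaining two unit
  arcs \<open>[1, 2)\<close> and \<open>[3, 4)\<close> as repelling and attracting regions, so these two maps play
  ping-pong.\<close>

definition pinch :: "rat \<Rightarrow> rat" where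
  "pinch r = (let q = of_int \<lfloor>r / 4\<rfloor>; t = r - 4 * q
     in 4 * q + (if t < 1 then 3 + 3 * t else 6 + (t - 1) / 3))"

lemma pinch_eq:
  assumes "0 \<le> t" "t < 4"
  shows "pinch (4 * of_int q + t) = 4 * of_int q + (if t < 1 then 3 + 3 * t else 6 + (t - 1) / 3)"
proof -
  have "\<lfloor>(4 * of_int q + t) / 4\<rfloor> = q"
    using assms by (simp add: floor_eq_iff)
  then show ?thesis by (simp add: pinch_def Let_def)
qed

lemma rat_mod_4_cases:
  obtains q :: int and t :: rat where "r = 4 * of_int q + t" "0 \<le> t" "t < 4"
proof (rule that)
  have "of_int \<lfloor>r / 4\<rfloor> \<le> r / 4" "r / 4 < of_int \<lfloor>r / 4\<rfloor> + 1" by linarith+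
  then show "0 \<le> r - 4 * of_int \<lfloor>r / 4\<rfloor>" "r - 4 * of_int \<lfloor>r / 4\<rfloor> < 4" by linarith+
qed simp

lemma pinch_gt: "r < pinch r"
proof -
  obtain q t where r: "r = 4 * of_int q + t" "0 \<le> t" "t < 4" by (rule rat_mod_4_cases)
  show ?thesis using pinch_eq[OF r(2,3), of q] r by (simp add: field_simps split: if_splits)
qed

lemma strict_mono_pinch: "strict_mono pinch"
proof (rule strict_monoI)
  fix r s :: rat assume rs: "r < s"
  obtain q t where r: "r = 4 * of_int q + t" "0 \<le> t" "t < 4" by (rule rat_mod_4_cases)
  obtain p u where s: "s = 4 * of_int p + u" "0 \<le> u" "u < 4" by (rule rat_mod_4_cases)
  note pinch_rs = pinch_eq[OF r(2,3), of q, folded r(1)] pinch_eq[OF s(2,3), of p, folded s(1)]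
  show "pinch r < pinch s"
  proof (cases "q = p")
    case True
    then show ?thesis using r s rs pinch_rs by (simp add: field_simps split: if_splits)
  next
    case False
    have "(of_int q :: rat) < of_int p + 1" using r s rs by linarith
    then have "q < p" using False by linarith
    then have "(of_int q :: rat) + 1 \<le> of_int p" by linarith
    then show ?thesis using r s pinch_rs by (simp add: field_simps split: if_splits)
  qed
qed

lemma surj_pinch: "surj pinch"
proof -
  have "\<exists>r. pinch r = y" for y
  proof -
    \<comment> \<open>The image of \<open>[4 q, 4 q + 4)\<close> is \<open>[4 q + 3, 4 q + 7)\<close>.\<close>
    obtain q t where y: "y - 3 = 4 * of_int q + t" "0 \<le> t" "t < 4" by (rule rat_mod_4_cases)
    define u where "u = (if t < 3 then t / 3 else 1 + 3 * (t - 3))"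
    have "pinch (4 * of_int q + u) = y"
      using y by (subst pinch_eq) (auto simp: u_def field_simps)
    then show ?thesis by blast
  qed
  then show ?thesis unfolding surj_def by metis
qed

lemma pinch_zone:
  assumes "\<lfloor>r\<rfloor> mod 4 \<noteq> 0"
  shows "\<lfloor>pinch r\<rfloor> mod 4 = 2"
proof -
  obtain q t where r: "r = 4 * of_int q + t" "0 \<le> t" "t < 4" by (rule rat_mod_4_cases)
  have "\<not> t < 1"
  proof
    assume "t < 1"
    then have "\<lfloor>r\<rfloor> = 4 * q" using r by (intro floor_unique) simp_all
    then show False using assms by simp
  qed
  then have "\<lfloor>pinch r\<rfloor> = 4 * q + 6" using r by (intro floor_unique) (simp_all add: pinch_eq)
  then show ?thesis by presburger
qed

text \<open>The regions are the residue classes of the integer part modulo 4. A start in a region different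
  both from the repelling region of the last syllable, which acts first, and from the attracting
  region of the first syllable, where the point ends, is moved by the word.\<close>

lemma irreducible_word_nontrivial:
  assumes n: "1 \<le> n" and w: "irreducible_word w"
  shows "\<exists>F\<in>Aut_plus n. \<exists>G\<in>Aut n. eval_word (Aut_group n) F G w \<noteq> \<one>\<^bsub>Aut_group n\<^esub>"
proof -
  let ?C = "chain_antichains n"
  define F where "F = (\<lambda>x\<in>?C. (fst x, pinch (snd x)))"
  define G where "G = (\<lambda>x\<in>?C. (fst x, pinch (snd x - 1) + 1))"
  have F: "F \<in> Aut n"
    unfolding F_def by (rule Aut_of_order_bijection[OF strict_mono_pinch surj_pinch])
  have "strict_mono (\<lambda>r. pinch (r - 1) + 1)"
    by (auto intro!: strict_monoI simp: strict_mono_less[OF strict_mono_pinch])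
  moreover have "surj (\<lambda>r. pinch (r - 1) + 1)"
  proof (rule surjI)
    show "pinch ((inv_into UNIV pinch (y - 1) + 1) - 1) + 1 = y" for y
      by (simp add: surj_f_inv_f[OF surj_pinch])
  qed
  ultimately have G: "G \<in> Aut n" unfolding G_def by (rule Aut_of_order_bijection)
  have Fplus: "F \<in> Aut_plus n" using F pinch_gt by (simp add: Aut_plus_def F_def)
  define cls where "cls x = \<lfloor>snd x\<rfloor> mod 4" for x :: "nat \<times> rat"
  define zone :: "letter \<Rightarrow> bool \<Rightarrow> int" where
    "zone c s = (if c = LetterA then (if s then 2 else 0) else (if s then 3 else 1))" for c s
  have ping: "cls (eval_letter F G c x) = zone c True"
    if x: "x \<in> ?C" "cls x \<noteq> zone c False" for c x
  proof (cases c)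
    case LetterA
    then show ?thesis using x pinch_zone[of "snd x"] by (simp add: cls_def zone_def F_def)
  next
    case LetterB
    then have "\<lfloor>snd x\<rfloor> mod 4 \<noteq> 1" using x by (simp add: cls_def zone_def)
    then have "\<lfloor>snd x - 1\<rfloor> mod 4 \<noteq> 0" by simp presburger
    then have "\<lfloor>pinch (snd x - 1)\<rfloor> mod 4 = 2" by (rule pinch_zone)
    then have "\<lfloor>pinch (snd x - 1) + 1\<rfloor> mod 4 = 3" by simp presburger
    then show ?thesis using x LetterB by (simp add: cls_def zone_def G_def)
  qed
  have zone: "zone c s = zone d t \<longleftrightarrow> c = d \<and> s = t" for c s d t
    by (cases c; cases d) (auto simp: zone_def)
  have E: "eval_letter F G c \<in> Aut n" for c by (cases c) (simp_all add: F G)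
  define bad where "bad = {zone (fst (last w)) (snd (last w) < 0), zone (fst (hd w)) (snd (hd w) > 0)}"
  have "\<not> {0, 1, 2} \<subseteq> bad"
  proof
    assume "{0, 1, 2} \<subseteq> bad"
    then have "card {0, 1, 2 :: int} \<le> card bad" by (intro card_mono) (simp_all add: bad_def)
    moreover have "card bad \<le> 2" unfolding bad_def by (simp add: card_insert_if)
    ultimately show False by simp
  qed
  then obtain i :: int where i: "i \<in> {0, 1, 2}" "i \<notin> bad" by blast
  define x :: "nat \<times> rat" where "x = (1, of_int i)"
  have x: "x \<in> ?C" using n by (simp add: x_def chain_antichains_def index_set_def one_enat_def)
  have cx: "cls x = i" using i(1) by (auto simp: cls_def x_def)
  have "cls (eval_word (Aut_group n) F G w x) = zone (fst (hd w)) (snd (hd w) > 0)"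
    using eval_word_ping_pong[of F G n zone cls w x, OF E zone ping w x] cx i(2) by (auto simp: bad_def)
  then have "eval_word (Aut_group n) F G w x \<noteq> x" using cx i(2) by (auto simp: bad_def)
  then have "eval_word (Aut_group n) F G w \<noteq> \<one>\<^bsub>Aut_group n\<^esub>" using one_Aut_apply[OF x] by auto
  then show ?thesis using Fplus G by blast
qed

section \<open>Genericity of free pairs and of cyclically dense tuples\<close>

instance letter :: countable by countable_datatype

abbreviation pair_topology :: "enat \<Rightarrow> ((nat \<times> rat \<Rightarrow> nat \<times> rat) \<times> (nat \<times> rat \<Rightarrow> nat \<times> rat)) topology" where
  "pair_topology n \<equiv> prod_topology (subtopology (Aut_topology n) (Aut_plus n)) (Aut_topology n)"

lemma topspace_pair_topology: "topspace (pair_topology n) = Aut_plus n \<times> Aut n"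
  by (auto simp: Aut_plus_def)

lemma continuous_map_pair_fst: "continuous_map (pair_topology n) (Aut_topology n) fst"
  by (metis continuous_map_fst continuous_map_in_subtopology)

lemma continuous_map_pair_snd: "continuous_map (pair_topology n) (Aut_topology n) snd"
  by (rule continuous_map_snd)

text \<open>The pairs on which \<open>w\<close> does not vanish form an open set that is invariant under simultaneous
  conjugation and contains a ping-pong pair. Up to conjugation by a power of the translation, a pair
  in an arbitrary open set \<open>U\<close> can be arranged to agree with the ping-pong pair on a finite set that
  witnesses the nontriviality of \<open>w\<close>; hence the open set is dense.\<close>

lemma comeager_word_nontrivial:
  assumes n: "1 \<le> n" and w: "irreducible_word w"
  shows "comeager_in (pair_topology n)
    {z \<in> topspace (pair_topology n). eval_word (Aut_group n) (fst z) (snd z) w \<noteq> \<one>\<^bsub>Aut_group n\<^esub>}"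
    (is "comeager_in _ ?W")
proof (rule comeager_in_open_dense)
  interpret group "Aut_group n" by (rule group_Aut_group)
  let ?C = "chain_antichains n" and ?e = "\<lambda>z. eval_word (Aut_group n) (fst z) (snd z) w"
  have cont: "continuous_map (pair_topology n) (Aut_topology n) ?e"
    by (rule continuous_map_Aut_eval_word[OF continuous_map_pair_fst continuous_map_pair_snd])
  have e_mem: "?e z \<in> Aut n" if "z \<in> topspace (pair_topology n)" for z
    using continuous_map_Aut_mem[OF cont that] .
  have "openin (pair_topology n) (\<Union>x\<in>?C. \<Union>y\<in>- {x}. {z \<in> topspace (pair_topology n). ?e z x = y})"
    using continuous_map_Aut_value[OF cont] by (intro openin_Union ballI) blast
  moreover have "(\<Union>x\<in>?C. \<Union>y\<in>- {x}. {z \<in> topspace (pair_topology n). ?e z x = y}) = ?W"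
  proof (intro equalityI subsetI)
    fix z assume "z \<in> (\<Union>x\<in>?C. \<Union>y\<in>- {x}. {z \<in> topspace (pair_topology n). ?e z x = y})"
    then obtain x where "x \<in> ?C" "z \<in> topspace (pair_topology n)" "?e z x \<noteq> x" by auto
    then show "z \<in> ?W" using one_Aut_apply[of x n] by auto
  next
    fix z assume z: "z \<in> ?W"
    then have "\<exists>x\<in>?C. ?e z x \<noteq> x"
      using Aut_eqI[OF e_mem[of z], of "\<one>\<^bsub>Aut_group n\<^esub>"] one_closed one_Aut_apply by auto
    then show "z \<in> (\<Union>x\<in>?C. \<Union>y\<in>- {x}. {z \<in> topspace (pair_topology n). ?e z x = y})"
      using z by auto
  qed
  ultimately show W: "openin (pair_topology n) ?W" by simp
  fix U assume U: "openin (pair_topology n) U" "U \<noteq> {}"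
  obtain F G where FG: "(F, G) \<in> U" using U(2) by auto
  then have FGm: "F \<in> Aut_plus n" "F \<in> Aut n" "G \<in> Aut n"
    using openin_subset[OF U(1)] unfolding topspace_pair_topology by (auto simp: Aut_plus_def)
  obtain F' G' where F'G': "F' \<in> Aut_plus n" "G' \<in> Aut n" "eval_word (Aut_group n) F' G' w \<noteq> \<one>\<^bsub>Aut_group n\<^esub>"
    using irreducible_word_nontrivial[OF n w] by blast
  then have W': "(F', G') \<in> ?W" and F'm: "F' \<in> Aut n"
    unfolding topspace_pair_topology by (simp_all add: Aut_plus_def)
  obtain D where D: "finite D" "D \<subseteq> ?C"
      "\<And>A B. \<lbrakk>A \<in> Aut n; A \<in> Aut_plus n; B \<in> Aut n; \<forall>x\<in>D. A x = F x; \<forall>x\<in>D. B x = G x\<rbrakk> \<Longrightarrow> (A, B) \<in> U"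
    by (rule prod_Aut_neighbourhood[OF U(1) FG]) blast
  obtain Y where Y: "finite Y" "Y \<subseteq> ?C"
      "\<And>A B. \<lbrakk>A \<in> Aut n; A \<in> Aut_plus n; B \<in> Aut n; \<forall>x\<in>Y. A x = F' x; \<forall>x\<in>Y. B x = G' x\<rbrakk> \<Longrightarrow> (A, B) \<in> ?W"
    by (rule prod_Aut_neighbourhood[OF W W']) blast
  let ?K = "translation n"
  note K = uniformly_increasing_translation[of n]
  have Km: "?K \<in> Aut n" using K by (simp add: uniformly_increasing_def)
  obtain k :: int where k: "\<forall>j\<le>k. \<exists>A\<in>Aut n. (\<forall>x\<in>D. A x = F x) \<and>
      (\<forall>y\<in>Y. (?K [^]\<^bsub>Aut_group n\<^esub> j \<otimes>\<^bsub>Aut_group n\<^esub> A \<otimes>\<^bsub>Aut_group n\<^esub> ?K [^]\<^bsub>Aut_group n\<^esub> (- j)) y = F' y) \<and>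
      (F \<in> Aut_plus n \<longrightarrow> F' \<in> Aut_plus n \<longrightarrow> uniformly_increasing n A)"
    using conjugates_transitive[OF K FGm(2) F'm D(1,2) Y(1,2)] by blast
  obtain l :: int where l: "\<forall>j\<le>l. \<exists>B\<in>Aut n. (\<forall>x\<in>D. B x = G x) \<and>
      (\<forall>y\<in>Y. (?K [^]\<^bsub>Aut_group n\<^esub> j \<otimes>\<^bsub>Aut_group n\<^esub> B \<otimes>\<^bsub>Aut_group n\<^esub> ?K [^]\<^bsub>Aut_group n\<^esub> (- j)) y = G' y) \<and>
      (G \<in> Aut_plus n \<longrightarrow> G' \<in> Aut_plus n \<longrightarrow> uniformly_increasing n B)"
    using conjugates_transitive[OF K FGm(3) F'G'(2) D(1,2) Y(1,2)] by blast
  define j where "j = min k l"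
  have jk: "j \<le> k" "j \<le> l" by (simp_all add: j_def)
  obtain A where A: "A \<in> Aut n" "\<forall>x\<in>D. A x = F x"
      "\<forall>y\<in>Y. (?K [^]\<^bsub>Aut_group n\<^esub> j \<otimes>\<^bsub>Aut_group n\<^esub> A \<otimes>\<^bsub>Aut_group n\<^esub> ?K [^]\<^bsub>Aut_group n\<^esub> (- j)) y = F' y"
      "uniformly_increasing n A"
    using k[rule_format, OF jk(1)] FGm(1) F'G'(1) by blast
  obtain B where B: "B \<in> Aut n" "\<forall>x\<in>D. B x = G x"
      "\<forall>y\<in>Y. (?K [^]\<^bsub>Aut_group n\<^esub> j \<otimes>\<^bsub>Aut_group n\<^esub> B \<otimes>\<^bsub>Aut_group n\<^esub> ?K [^]\<^bsub>Aut_group n\<^esub> (- j)) y = G' y"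
    using l[rule_format, OF jk(2)] by blast
  define P where "P = ?K [^]\<^bsub>Aut_group n\<^esub> j"
  have P: "P \<in> Aut n" using int_pow_closed[of ?K j] Km by (simp add: P_def)
  have iP: "?K [^]\<^bsub>Aut_group n\<^esub> (- j) = inv\<^bsub>Aut_group n\<^esub> P"
    using int_pow_neg[of ?K j] Km by (simp add: P_def)
  note AP = A(3)[unfolded iP P_def[symmetric]] and BP = B(3)[unfolded iP P_def[symmetric]]
  have Aplus: "A \<in> Aut_plus n" using A(4) by (rule uniformly_increasing_imp_Aut_plus)
  have AU: "(A, B) \<in> U" using D(3) A B Aplus by blast
  let ?c = "\<lambda>H. P \<otimes>\<^bsub>Aut_group n\<^esub> H \<otimes>\<^bsub>Aut_group n\<^esub> inv\<^bsub>Aut_group n\<^esub> P"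
  interpret conj: group_hom "Aut_group n" "Aut_group n" ?c
    using conj_hom[of P] P by simp
  have cA: "?c A \<in> Aut_plus n" by (rule conj_Aut_plus[OF P Aplus])
  then have cA': "?c A \<in> Aut n" by (simp add: Aut_plus_def)
  have cB: "?c B \<in> Aut n" using conj.hom_closed[of B] B(1) by simp
  have "(?c A, ?c B) \<in> ?W" by (rule Y(3)[OF cA' cA cB AP BP])
  then have "eval_word (Aut_group n) (?c A) (?c B) w \<noteq> \<one>\<^bsub>Aut_group n\<^esub>" by simp
  then have "eval_word (Aut_group n) A B w \<noteq> \<one>\<^bsub>Aut_group n\<^esub>"
    using conj.hom_eval_word[of A B w] A(1) B(1) conj.hom_one by auto
  then have "(A, B) \<in> ?W" using AU openin_subset[OF U(1)] by auto
  then show "?W \<inter> U \<noteq> {}" using AU by blast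
qed

text \<open>This gives more than density of the generated subgroup: already the conjugates of \<open>G\<close> by the
  powers of \<open>F\<close> are dense. For transitivity the first component is chosen uniformly increasing inside
  the given open set, and the second component is then adapted to it.\<close>

lemma comeager_pair_conjugates_dense:
  "comeager_in (pair_topology n) {z \<in> topspace (pair_topology n).
     dense_in (Aut_topology n) (range (\<lambda>k::int. fst z [^]\<^bsub>Aut_group n\<^esub> k \<otimes>\<^bsub>Aut_group n\<^esub> snd z \<otimes>\<^bsub>Aut_group n\<^esub> fst z [^]\<^bsub>Aut_group n\<^esub> (- k)))}"
proof -
  obtain \<B> where base: "countable_pi_base (Aut_topology n) \<B>" using countable_pi_base_Aut by blast
  show ?thesis
  proof (rule comeager_dense_orbit[OF base])
    show "continuous_map (pair_topology n) (Aut_topology n) (\<lambda>z. fst z [^]\<^bsub>Aut_group n\<^esub> k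
        \<otimes>\<^bsub>Aut_group n\<^esub> snd z \<otimes>\<^bsub>Aut_group n\<^esub> fst z [^]\<^bsub>Aut_group n\<^esub> (- k))" for k :: int
      by (intro continuous_map_Aut_mult continuous_map_Aut_int_pow continuous_map_pair_fst continuous_map_pair_snd)
    fix U V assume U: "openin (pair_topology n) U" "U \<noteq> {}" and V: "openin (Aut_topology n) V" "V \<noteq> {}"
    let ?C = "chain_antichains n"
    obtain F G where FG: "(F, G) \<in> U" using U(2) by auto
    then have FGm: "F \<in> Aut_plus n" "F \<in> Aut n" "G \<in> Aut n"
      using openin_subset[OF U(1)] unfolding topspace_pair_topology by (auto simp: Aut_plus_def)
    obtain H where H: "H \<in> V" using V(2) by blast
    then have Hm: "H \<in> Aut n" using openin_subset[OF V(1)] by auto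
    obtain D where D: "finite D" "D \<subseteq> ?C"
        "\<And>A B. \<lbrakk>A \<in> Aut n; A \<in> Aut_plus n; B \<in> Aut n; \<forall>x\<in>D. A x = F x; \<forall>x\<in>D. B x = G x\<rbrakk> \<Longrightarrow> (A, B) \<in> U"
      by (rule prod_Aut_neighbourhood[OF U(1) FG]) blast
    obtain Y where Y: "finite Y" "Y \<subseteq> ?C" "\<And>A. \<lbrakk>A \<in> Aut n; \<forall>x\<in>Y. A x = H x\<rbrakk> \<Longrightarrow> A \<in> V"
      by (rule Aut_neighbourhood[OF V(1) H]) blast
    obtain K where K: "K \<in> Aut n" "\<forall>x\<in>D. K x = F x" "uniformly_increasing n K"
      using glue_automorphisms[OF FGm(2,2) D(1,2), of "{}"] FGm(1) by auto
    obtain k :: int where "\<forall>j\<le>k. \<exists>B\<in>Aut n. (\<forall>x\<in>D. B x = G x) \<and>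
        (\<forall>y\<in>Y. (K [^]\<^bsub>Aut_group n\<^esub> j \<otimes>\<^bsub>Aut_group n\<^esub> B \<otimes>\<^bsub>Aut_group n\<^esub> K [^]\<^bsub>Aut_group n\<^esub> (- j)) y = H y) \<and>
        (G \<in> Aut_plus n \<longrightarrow> H \<in> Aut_plus n \<longrightarrow> uniformly_increasing n B)"
      using conjugates_transitive[OF K(3) FGm(3) Hm D(1,2) Y(1,2)] by blast
    from this[rule_format, OF order_refl] obtain B where B: "B \<in> Aut n" "\<forall>x\<in>D. B x = G x"
        "\<forall>y\<in>Y. (K [^]\<^bsub>Aut_group n\<^esub> k \<otimes>\<^bsub>Aut_group n\<^esub> B \<otimes>\<^bsub>Aut_group n\<^esub> K [^]\<^bsub>Aut_group n\<^esub> (- k)) y = H y"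
      by blast
    have "(K, B) \<in> U"
      using D(3)[OF K(1) uniformly_increasing_imp_Aut_plus[OF K(3)] B(1) K(2) B(2)] .
    interpret group "Aut_group n" by (rule group_Aut_group)
    have "K [^]\<^bsub>Aut_group n\<^esub> k \<otimes>\<^bsub>Aut_group n\<^esub> B \<otimes>\<^bsub>Aut_group n\<^esub> K [^]\<^bsub>Aut_group n\<^esub> (- k) \<in> carrier (Aut_group n)"
      using K(1) B(1) by (intro m_closed int_pow_closed) simp_all
    then have "K [^]\<^bsub>Aut_group n\<^esub> k \<otimes>\<^bsub>Aut_group n\<^esub> B \<otimes>\<^bsub>Aut_group n\<^esub> K [^]\<^bsub>Aut_group n\<^esub> (- k) \<in> V"
      using Y(3) B(3) by simp
    with \<open>(K, B) \<in> U\<close> show "\<exists>k::int. \<exists>z\<in>U. fst z [^]\<^bsub>Aut_group n\<^esub> k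
        \<otimes>\<^bsub>Aut_group n\<^esub> snd z \<otimes>\<^bsub>Aut_group n\<^esub> fst z [^]\<^bsub>Aut_group n\<^esub> (- k) \<in> V"
      by (intro exI[of _ k] bexI[of _ "(K, B)"]) simp_all
  qed
qed

theorem comeager_freely_generate_dense:
  assumes n: "1 \<le> n"
  shows "comeager_in (pair_topology n)
    {(F, G). F \<in> Aut_plus n \<and> G \<in> Aut n \<and>
      freely_generate_dense_subgroup (Aut_group n) (Aut_topology n) F G}"
proof -
  let ?Z = "topspace (pair_topology n)"
  let ?N = "\<lambda>w. {z \<in> ?Z. eval_word (Aut_group n) (fst z) (snd z) w \<noteq> \<one>\<^bsub>Aut_group n\<^esub>}"
  let ?D = "{z \<in> ?Z. dense_in (Aut_topology n) (range (\<lambda>k::int. fst z [^]\<^bsub>Aut_group n\<^esub> k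
    \<otimes>\<^bsub>Aut_group n\<^esub> snd z \<otimes>\<^bsub>Aut_group n\<^esub> fst z [^]\<^bsub>Aut_group n\<^esub> (- k)))}"
  have "comeager_in (pair_topology n) (?Z \<inter> (\<Inter>w\<in>{w. irreducible_word w}. ?N w))"
    by (rule comeager_in_INT) (use comeager_word_nontrivial[OF n] in auto)
  then have "comeager_in (pair_topology n) ((?Z \<inter> (\<Inter>w\<in>{w. irreducible_word w}. ?N w)) \<inter> ?D)"
    by (rule comeager_in_Int[OF _ comeager_pair_conjugates_dense])
  then show ?thesis
  proof (rule comeager_in_mono)
    show "(?Z \<inter> (\<Inter>w\<in>{w. irreducible_word w}. ?N w)) \<inter> ?D \<subseteq> {(F, G). F \<in> Aut_plus n \<and> G \<in> Aut n \<and>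
      freely_generate_dense_subgroup (Aut_group n) (Aut_topology n) F G}"
    proof
      fix z assume z: "z \<in> (?Z \<inter> (\<Inter>w\<in>{w. irreducible_word w}. ?N w)) \<inter> ?D"
      obtain F G where FG: "z = (F, G)" by (cases z)
      have m: "F \<in> Aut_plus n" "G \<in> Aut n" "F \<in> Aut n"
        using z unfolding topspace_pair_topology FG by (auto simp: Aut_plus_def)
      interpret group "Aut_group n" by (rule group_Aut_group)
      have gen: "generate (Aut_group n) {F, G} \<subseteq> topspace (Aut_topology n)"
        using generate_incl[of "{F, G}"] m by simp
      have sub: "range (\<lambda>k::int. F [^]\<^bsub>Aut_group n\<^esub> k \<otimes>\<^bsub>Aut_group n\<^esub> G \<otimes>\<^bsub>Aut_group n\<^esub> F [^]\<^bsub>Aut_group n\<^esub> (- k))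
          \<subseteq> generate (Aut_group n) {F, G}"
        using conj_pow_in_generate[of F G] m by auto
      have "dense_in (Aut_topology n) (generate (Aut_group n) {F, G})"
        unfolding dense_in_iff_meets_open
      proof (intro conjI gen allI impI)
        fix U assume U: "openin (Aut_topology n) U \<and> U \<noteq> {}"
        have "dense_in (Aut_topology n) (range (\<lambda>k::int. F [^]\<^bsub>Aut_group n\<^esub> k
            \<otimes>\<^bsub>Aut_group n\<^esub> G \<otimes>\<^bsub>Aut_group n\<^esub> F [^]\<^bsub>Aut_group n\<^esub> (- k)))"
          using z FG by simp
        then show "generate (Aut_group n) {F, G} \<inter> U \<noteq> {}"
          using U sub unfolding dense_in_iff_meets_open by blast
      qed
      moreover have "eval_word (Aut_group n) F G w \<noteq> \<one>\<^bsub>Aut_group n\<^esub>" if "irreducible_word w" for w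
        using z FG that by simp
      ultimately show "z \<in> {(F, G). F \<in> Aut_plus n \<and> G \<in> Aut n \<and>
          freely_generate_dense_subgroup (Aut_group n) (Aut_topology n) F G}"
        using m FG by (simp add: freely_generate_dense_subgroup_def)
    qed
  qed (unfold topspace_pair_topology, auto)
qed

text \<open>A single conjugating automorphism, the translation, serves all tuples of a comeager set.\<close>

theorem comeager_cyclically_dense:
  "comeager_in (product_topology (\<lambda>_. Aut_topology n) {1..m})
     {g \<in> {1..m} \<rightarrow>\<^sub>E Aut n. cyclically_dense (Aut_group n) (Aut_topology n) m g}"
proof -
  interpret group "Aut_group n" by (rule group_Aut_group)
  let ?I = "{1..m}" and ?C = "chain_antichains n" and ?K = "translation n"
  let ?X = "product_topology (\<lambda>_. Aut_topology n) ?I"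
  let ?c = "\<lambda>(k::int) H. ?K [^]\<^bsub>Aut_group n\<^esub> k \<otimes>\<^bsub>Aut_group n\<^esub> H \<otimes>\<^bsub>Aut_group n\<^esub> ?K [^]\<^bsub>Aut_group n\<^esub> (- k)"
  note K = uniformly_increasing_translation[of n]
  have Km: "?K \<in> Aut n" using K by (simp add: uniformly_increasing_def)
  have pow: "?K [^]\<^bsub>Aut_group n\<^esub> (k::int) \<in> Aut n" for k using int_pow_closed[of ?K k] Km by simp
  have cmem: "?c k H \<in> Aut n" if "H \<in> Aut n" for k H
    using m_closed[OF m_closed[of "?K [^]\<^bsub>Aut_group n\<^esub> k" H], of "?K [^]\<^bsub>Aut_group n\<^esub> (- k)"] pow that
    by simp
  obtain \<B> where "countable_pi_base (Aut_topology n) \<B>" using countable_pi_base_Aut by blast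
  then have base: "countable_pi_base ?X ((\<lambda>B. Pi\<^sub>E ?I B) ` (?I \<rightarrow>\<^sub>E \<B>))"
    by (rule countable_pi_base_product) simp
  have "comeager_in ?X {g \<in> topspace ?X. dense_in ?X (range (\<lambda>k. \<lambda>i\<in>?I. ?c k (g i)))}"
  proof (rule comeager_dense_orbit[OF base])
    show "continuous_map ?X ?X (\<lambda>g. \<lambda>i\<in>?I. ?c k (g i))" for k
    proof (unfold continuous_map_componentwise, intro conjI ballI)
      fix i assume i: "i \<in> ?I"
      have "continuous_map ?X (Aut_topology n) (\<lambda>g. ?c k (g i))"
        by (intro continuous_map_Aut_mult continuous_map_Aut_const pow continuous_map_product_projection i)
      then show "continuous_map ?X (Aut_topology n) (\<lambda>g. (\<lambda>i\<in>?I. ?c k (g i)) i)" using i by simp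
    qed auto
    fix U V assume U: "openin ?X U" "U \<noteq> {}" and V: "openin ?X V" "V \<noteq> {}"
    obtain g where g: "g \<in> U" using U(2) by blast
    obtain h where h: "h \<in> V" using V(2) by blast
    have gm: "g i \<in> Aut n" and hm: "h i \<in> Aut n" if "i \<in> ?I" for i
      using g h openin_subset[OF U(1)] openin_subset[OF V(1)] that by (auto dest!: subsetD PiE_mem)
    obtain D where D: "finite D" "D \<subseteq> ?C"
        "\<And>g'. g' \<in> ?I \<rightarrow>\<^sub>E Aut n \<Longrightarrow> \<forall>i\<in>?I. \<forall>x\<in>D. g' i x = g i x \<Longrightarrow> g' \<in> U"
      by (rule product_Aut_neighbourhood[OF U(1) g]) auto
    obtain Y where Y: "finite Y" "Y \<subseteq> ?C"
        "\<And>g'. g' \<in> ?I \<rightarrow>\<^sub>E Aut n \<Longrightarrow> \<forall>i\<in>?I. \<forall>x\<in>Y. g' i x = h i x \<Longrightarrow> g' \<in> V"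
      by (rule product_Aut_neighbourhood[OF V(1) h]) auto
    have "\<forall>i\<in>?I. \<exists>k0. \<forall>k\<le>k0. \<exists>F\<in>Aut n. (\<forall>x\<in>D. F x = g i x) \<and> (\<forall>y\<in>Y. ?c k F y = h i y)"
    proof
      fix i assume "i \<in> ?I"
      from conjugates_transitive[OF K gm[OF this] hm[OF this] D(1,2) Y(1,2)]
      show "\<exists>k0. \<forall>k\<le>k0. \<exists>F\<in>Aut n. (\<forall>x\<in>D. F x = g i x) \<and> (\<forall>y\<in>Y. ?c k F y = h i y)" by blast
    qed
    then obtain k0 where k0: "\<forall>i\<in>?I. \<forall>k\<le>k0 i. \<exists>F\<in>Aut n. (\<forall>x\<in>D. F x = g i x) \<and> (\<forall>y\<in>Y. ?c k F y = h i y)"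
      by (rule bchoice[THEN exE])
    \<comment> \<open>One exponent that works in all coordinates.\<close>
    define k where "k = Min (insert 0 (k0 ` ?I))"
    have "\<forall>i\<in>?I. \<exists>F. F \<in> Aut n \<and> (\<forall>x\<in>D. F x = g i x) \<and> (\<forall>y\<in>Y. ?c k F y = h i y)"
    proof
      fix i assume i: "i \<in> ?I"
      then have "k \<le> k0 i" unfolding k_def by (intro Min_le) auto
      with k0 i show "\<exists>F. F \<in> Aut n \<and> (\<forall>x\<in>D. F x = g i x) \<and> (\<forall>y\<in>Y. ?c k F y = h i y)" by blast
    qed
    then obtain F where F: "\<forall>i\<in>?I. F i \<in> Aut n \<and> (\<forall>x\<in>D. F i x = g i x) \<and> (\<forall>y\<in>Y. ?c k (F i) y = h i y)"
      by (rule bchoice[THEN exE])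
    have "restrict F ?I \<in> U" by (rule D(3)) (use F in auto)
    moreover have "(\<lambda>i\<in>?I. ?c k (restrict F ?I i)) \<in> V"
      by (rule Y(3)) (use F cmem in auto)
    ultimately show "\<exists>k. \<exists>g\<in>U. (\<lambda>i\<in>?I. ?c k (g i)) \<in> V" by blast
  qed
  then show ?thesis
  proof (rule comeager_in_mono)
    show "{g \<in> topspace ?X. dense_in ?X (range (\<lambda>k. \<lambda>i\<in>?I. ?c k (g i)))}
        \<subseteq> {g \<in> ?I \<rightarrow>\<^sub>E Aut n. cyclically_dense (Aut_group n) (Aut_topology n) m g}"
      using Km by (auto simp: cyclically_dense_def)
  qed auto
qed

theorem corollary5p8:
  fixes n :: enat
  assumes "1 \<le> n"
  shows
    "comeager_in
       (prod_topology (subtopology (Aut_topology n) (Aut_plus n)) (Aut_topology n))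
       {(F, G). F \<in> Aut_plus n \<and> G \<in> Aut n \<and>
          freely_generate_dense_subgroup (Aut_group n) (Aut_topology n) F G} \<and>
     (\<forall>m::nat. 1 \<le> m \<longrightarrow>
       comeager_in
         (product_topology (\<lambda>_. Aut_topology n) {1..m})
         {g \<in> {1..m} \<rightarrow>\<^sub>E Aut n.
            cyclically_dense (Aut_group n) (Aut_topology n) m g})"
  using comeager_freely_generate_dense[OF assms] comeager_cyclically_dense by blast

end
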